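(* There are absolute constants such that the following holds. Let $\chi$ be a real primitive Dirichlet character of conductor $D$ (with $D$ large enough that $\log\log D>1$), and suppose that $L(s,\chi)=\sum_{n\ge1}\chi(n)n^{-s}$ has a real zero $\beta>3/4$ which is its only zero in the half-plane $\mathrm{Re}\,s>3/4$. Put $$\omega=\min\{1,(1-\beta)\log\log D\}.$$ Then $$L(1,\chi)\asymp \omega\exp\Bigl(\sum_{p\leq \log D}\frac{\chi(p)}{p}\Bigr),$$ where $p$ runs over primes and the implied constants are absolute. Consequently $$\omega(\log\log D)^{-1}\ll L(1,\chi)\ll \omega\log\log D,$$ and in particular, if $1-\beta\ll(\log\log D)^{-1}$, then $$1-\beta\ll L(1,\chi)\ll(1-\beta)(\log\log D)^2.$$
   Context: A real primitive character modulo $D$ is a primitive Dirichlet character of conductor $D$ taking only real values. $A\ll B$ means $|A|\leq cB$ for an absolute constant $c>0$ (in the last implication, depending only on the implied constant in the hypothesis $1-\beta\ll(\log\log D)^{-1}$), and $A\asymp B$ means $A\ll B$ and $B\ll A$. *)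

theory Defs
  imports "HOL-Complex_Analysis.Complex_Analysis" "HOL-Number_Theory.Number_Theory"
begin

text \<open>
  Dirichlet characters modulo \<open>D\<close> are represented by their restriction to the
  non-negative integers, which determines them by periodicity.
\<close>

definition dirichlet_character :: "nat \<Rightarrow> (nat \<Rightarrow> complex) \<Rightarrow> bool" where
  "dirichlet_character D chi \<longleftrightarrow>
     D > 0 \<and>
     (\<forall>m n. chi (m * n) = chi m * chi n) \<and>
     (\<forall>n. chi (n + D) = chi n) \<and>
     (\<forall>n. chi n \<noteq> 0 \<longleftrightarrow> coprime n D)"

definition induced_modulus :: "nat \<Rightarrow> (nat \<Rightarrow> complex) \<Rightarrow> nat \<Rightarrow> bool" where
  "induced_modulus D chi d \<longleftrightarrow>
     d dvd D \<and> (\<exists>\<psi>. dirichlet_character d \<psi> \<and> (\<forall>n. coprime n D \<longrightarrow> chi n = \<psi> n))"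

definition conductor :: "nat \<Rightarrow> (nat \<Rightarrow> complex) \<Rightarrow> nat" where
  "conductor D chi = (LEAST d. induced_modulus D chi d)"

definition real_primitive_character :: "nat \<Rightarrow> (nat \<Rightarrow> complex) \<Rightarrow> bool" where
  "real_primitive_character D chi \<longleftrightarrow>
     dirichlet_character D chi \<and> conductor D chi = D \<and> (\<forall>n. chi n \<in> \<real>)"

text \<open>
  For a non-principal character the (ordered) series converges for \<open>Re s > 0\<close>, so no
  analytic continuation is needed on the half-plane \<open>Re s > 3/4\<close>.  Every primitive
  character of conductor \<open>D > 1\<close> is non-principal.
\<close>

definition dirichlet_L :: "(nat \<Rightarrow> complex) \<Rightarrow> complex \<Rightarrow> complex" where
  "dirichlet_L chi s = (\<Sum>n. chi (Suc n) * of_nat (Suc n) powr (- s))"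

definition unique_exceptional_zero :: "nat \<Rightarrow> (nat \<Rightarrow> complex) \<Rightarrow> real \<Rightarrow> bool" where
  "unique_exceptional_zero D chi \<beta> \<longleftrightarrow>
     real_primitive_character D chi \<and>
     ln (ln (real D)) > 1 \<and>
     \<beta> > 3/4 \<and>
     dirichlet_L chi (of_real \<beta>) = 0 \<and>
     (\<forall>s. Re s > 3/4 \<and> dirichlet_L chi s = 0 \<longrightarrow> s = of_real \<beta>)"

definition siegel_omega :: "nat \<Rightarrow> real \<Rightarrow> real" where
  "siegel_omega D \<beta> = min 1 ((1 - \<beta>) * ln (ln (real D)))"

text \<open>\<open>Re (chi p)\<close> is \<open>chi p\<close> itself for the real-valued characters considered.\<close>

definition prime_char_sum :: "nat \<Rightarrow> (nat \<Rightarrow> complex) \<Rightarrow> real" where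
  "prime_char_sum D chi = (\<Sum>p | prime p \<and> real p \<le> ln (real D). Re (chi p) / real p)"

end

theory Submission
  imports Defs
begin

text \<open>
  Put \<open>n \<approx> 16 log log D\<close> and write \<open>L(s) = (s - \<beta>)^m g(s)\<close>, where \<open>g\<close> has no
  zero in \<open>Re s > 3/4\<close>. In \<open>Re s \<ge> 1 + 1/n\<close> the Euler product gives \<open>L'/L = O(n)\<close>, while the
  Borel--Caratheodory theorem gives \<open>g'/g = O(log D)\<close>, which is exponential in \<open>n\<close>, on a
  slightly larger disc reaching to \<open>Re s = 7/8\<close>. A three circles argument then extends bounds \<open>O(n)\<close>
  from \<open>Re s \<ge> 1 + 1/n\<close> to a neighbourhood of \<open>[1 - 1/n, 1 + 1/n]\<close>, with a loss of a constant
  factor only.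

  It is first applied to \<open>L'/L\<close> multiplied by \<open>1 - (1 - 2(s - \<beta>))^n\<close>, a factor that cancels the
  pole at \<open>\<beta>\<close>, is bounded on the inner disc, and is bounded below on \<open>[1, 1 + 1/n]\<close> if
  \<open>1 - \<beta> \<ge> 1/n\<close>; in that case \<open>L(1)\<close> and \<open>L(1 + 1/n)\<close> are comparable. If \<open>1 - \<beta> < 1/n\<close>, the
  value of the product at \<open>\<beta>\<close> shows \<open>m = O(1)\<close>; then the argument applied to \<open>g'/g\<close> itself shows that
  \<open>g(1)\<close> and \<open>g(1 + 1/n)\<close> are comparable, and \<open>|L'/L| \<le> -\<zeta>'/\<zeta>\<close> to the right of \<open>1\<close> forces
  \<open>m = 1\<close> once \<open>(1 - \<beta>) n\<close> is small. Finally \<open>L(1 + 1/n)\<close> is compared with the exponential of the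
  prime sum through its Euler product; the tails are controlled by \<open>-\<zeta>'/\<zeta>(1 + 1/n) = O(n)\<close>.
\<close>

section \<open>Consequences of the maximum principle\<close>

text \<open>The obstacle: near Re s = 1 the available bound for g'/g is O(log D), while a comparison
  over an interval of length 1/n costs a constant factor only if the bound is O(n). The radii
  overcome this. Around 9/8 the inner and target radii differ by a factor 1 + O(1/n), whereas the
  outer radius is more than twice the inner one. So the n-th power of the radius absorbs an outer
  bound 2^n, which exceeds log D, yet grows by a constant factor between the inner and the target
  circle. The pole at \<beta> cannot simply be subtracted at the start: a priori m is only O(log D),
  and m/(s - \<beta>) may be as large as m n on the inner disc. The cancelling factor works without
  knowledge of m, and its growth (5/4)^n on the outer disc is admissible because log D is at most
  (8/5)^n and 8/5 times 5/4 is 2. Simplicity of a zero very close to 1 matters because a zero of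
  order m contributes the m-th power of (1 - \<beta>) n, where the theorem asserts the first
  power.\<close>

lemma norm_le_three_circles_power:
  fixes F :: "complex \<Rightarrow> complex"
  assumes hol: "F holomorphic_on ball c R" and cont: "continuous_on (cball c R) F"
    and r: "0 < r" "r < R"
    and inner: "\<And>z. z \<in> sphere c r \<Longrightarrow> norm (F z) \<le> A"
    and outer: "\<And>z. z \<in> sphere c R \<Longrightarrow> norm (F z) \<le> A * (R / r) ^ p"
    and z: "r \<le> dist c z" "dist c z \<le> R"
  shows "norm (F z) \<le> A * (dist c z / r) ^ p"
proof -
  define S where "S = cball c R - ball c r"
  \<comment> \<open>Division by the p-th power makes the bounds on the two circles equal, so the
    maximum principle applies to the annulus; an integer exponent keeps \<open>G\<close>
    single-valued.\<close>
  define G where "G = (\<lambda>z. F z / (z - c) ^ p)"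
  have clS: "closed S"
    unfolding S_def by (simp add: closed_Diff)
  have intS: "interior S = ball c R - cball c r"
    unfolding S_def by (simp add: interior_diff r interior_cball closure_ball)
  have fr: "w \<in> sphere c r \<union> sphere c R" if "w \<in> frontier S" for w
    using that clS intS unfolding frontier_def by (auto simp: S_def)
  have zS: "z \<in> S"
    using z by (auto simp: S_def)
  have ne: "w \<noteq> c" if "w \<in> S" for w
    using that r by (auto simp: S_def)
  have "norm (G z) \<le> A / r ^ p"
  proof (rule maximum_modulus_frontier[of G S])
    show "G holomorphic_on interior S"
      unfolding G_def intS using r
      by (intro holomorphic_intros holomorphic_on_subset[OF hol]) auto
    show "continuous_on (closure S) G"
      unfolding G_def using clS ne
      by (auto intro!: continuous_intros continuous_on_subset[OF cont] simp: S_def)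
    show "bounded S"
      unfolding S_def by (simp add: bounded_diff)
    show "norm (G w) \<le> A / r ^ p" if "w \<in> frontier S" for w
      using fr[OF that]
    proof
      assume w: "w \<in> sphere c r"
      then have "norm (w - c) = r" by (simp add: dist_norm norm_minus_commute)
      then show ?thesis
        using inner[OF w] r by (simp add: G_def norm_divide norm_power divide_right_mono)
    next
      assume w: "w \<in> sphere c R"
      then have "norm (w - c) = R" by (simp add: dist_norm norm_minus_commute)
      then show ?thesis
        using outer[OF w] r by (simp add: G_def norm_divide norm_power field_simps)
    qed
  qed (rule zS)
  moreover have "norm (G z) = norm (F z) / dist c z ^ p"
    by (simp add: G_def norm_divide norm_power dist_norm norm_minus_commute)
  moreover have "dist c z > 0" using z r by linarith
  ultimately show ?thesis
    by (simp add: field_simps)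
qed

text \<open>The map x -> x / (2M - x) carries the half-plane Re x \<le> M into the closed unit disc
  and fixes 0, so the Schwarz lemma applies to its composition with \<open>h\<close>; solving for
  \<open>h\<close> gives the bound.\<close>

lemma borel_caratheodory:
  fixes h :: "complex \<Rightarrow> complex"
  assumes hol: "h holomorphic_on ball c R" and h0: "h c = 0"
    and re: "\<And>z. z \<in> ball c R \<Longrightarrow> Re (h z) \<le> M" and M: "M > 0" and R: "R > 0"
    and z: "dist c z \<le> r" "r < R"
  shows "norm (h z) \<le> 2 * M * r / (R - r)"
proof -
  define w where "w = (\<lambda>u. h (c + of_real R * u) / (2 * of_real M - h (c + of_real R * u)))"
  have mem: "c + of_real R * u \<in> ball c R" if "norm u < 1" for u
    using that R by (simp add: dist_norm norm_mult)
  have ne: "2 * of_real M - h (c + of_real R * u) \<noteq> 0" if "norm u < 1" for u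
  proof
    assume "2 * of_real M - h (c + of_real R * u) = 0"
    then have "Re (2 * of_real M - h (c + of_real R * u)) = 0" by simp
    then show False using re[OF mem[OF that]] M by simp
  qed
  have lt: "norm (w u) \<le> 1" if "norm u < 1" for u
  proof -
    define x where "x = h (c + of_real R * u)"
    have x: "Re x \<le> M" unfolding x_def by (rule re[OF mem[OF that]])
    have "norm x \<le> norm (2 * of_real M - x)"
      unfolding cmod_def using x M
      by (intro real_sqrt_le_mono) (auto simp: power2_eq_square algebra_simps)
    then show ?thesis
      using ne[OF that] by (simp add: w_def x_def norm_divide)
  qed
  have holw: "w holomorphic_on ball 0 1"
  proof -
    have "(\<lambda>u. h (c + of_real R * u)) holomorphic_on ball 0 1"
      by (rule holomorphic_on_compose_gen[OF _ hol, unfolded o_def])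
         (use mem in \<open>auto intro!: holomorphic_intros\<close>)
    then show ?thesis
      unfolding w_def using ne by (intro holomorphic_intros) auto
  qed
  have w0: "w 0 = 0" by (simp add: w_def h0)
  \<comment> \<open>As the hypothesis on Re h is not strict, only norm \<le> 1 is immediate, while
    the Schwarz lemma asks for a strict inequality. By the maximum principle equality would make
    \<open>w\<close> constant, against \<open>w 0 = 0\<close>.\<close>
  have strict: "norm (w u) < 1" if u: "norm u < 1" for u
  proof (rule ccontr)
    assume "\<not> norm (w u) < 1"
    then have eq: "norm (w u) = 1" using lt[OF u] by simp
    have "w constant_on ball 0 1"
      using u lt eq by (intro maximum_modulus_principle[OF holw, of "ball 0 1" u]) auto
    then obtain k where "\<And>x. x \<in> ball 0 1 \<Longrightarrow> w x = k" unfolding constant_on_def by blast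
    then have "w u = w 0" using u by simp
    then show False using eq w0 by simp
  qed
  define u where "u = (z - c) / of_real R"
  have nu: "norm u = dist c z / R" using R by (simp add: u_def norm_divide dist_norm norm_minus_commute)
  then have u1: "norm u < 1" using z R by simp
  have zu: "c + of_real R * u = z" using R by (simp add: u_def)
  have wu: "norm (w u) \<le> r / R"
    using Schwarz_Lemma(1)[OF holw w0 strict u1] nu z R
    by (smt (verit) divide_right_mono)
  have eq: "h z * (1 + w u) = 2 * of_real M * w u"
    using ne[OF u1] unfolding w_def zu by (simp add: field_simps)
  have "norm (h z) * (1 - r / R) \<le> norm (h z) * norm (1 + w u)"
    using wu norm_triangle_ineq4[of "1 + w u" "w u"] by (intro mult_left_mono) auto
  also have "\<dots> = 2 * M * norm (w u)"
    using eq M by (metis abs_of_pos norm_mult norm_of_real of_real_mult of_real_numeral mult_pos_pos zero_less_numeral)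
  also have "\<dots> \<le> 2 * M * (r / R)"
    using wu M by (intro mult_left_mono) auto
  finally have "R * (norm (h z) * (1 - r / R)) \<le> R * (2 * M * (r / R))"
    using R by (intro mult_left_mono) auto
  moreover have "R * (norm (h z) * (1 - r / R)) = norm (h z) * (R - r)"
    using R by (simp add: field_simps)
  ultimately show ?thesis
    using R z by (simp add: pos_le_divide_eq)
qed

text \<open>A logarithm of g / g c has real part at most \<open>M\<close>, so Borel-Caratheodory
  bounds it up to the radius halfway between \<open>r\<close> and \<open>R\<close>. Cauchy's
  inequality on discs of radius (R - r)/2 then bounds its derivative, which is g'/g.\<close>

lemma norm_logderiv_le:
  fixes g :: "complex \<Rightarrow> complex"
  assumes hol: "g holomorphic_on ball c R" and nz: "\<And>z. z \<in> ball c R \<Longrightarrow> g z \<noteq> 0"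
    and bound: "\<And>z. z \<in> ball c R \<Longrightarrow> norm (g z) \<le> exp M * norm (g c)" and M: "M > 0"
    and r: "0 \<le> r" "r < R" and z: "dist c z \<le> r"
  shows "norm (deriv g z / g z) \<le> 8 * M * R / (R - r)\<^sup>2"
proof -
  obtain h0 where h0: "h0 holomorphic_on ball c R" "\<And>x. x \<in> ball c R \<Longrightarrow> exp (h0 x) = g x"
    using holomorphic_logarithm_exists[OF convex_ball open_ball hol nz, of c] r by auto
  define h where "h = (\<lambda>x. h0 x - h0 c)"
  have h: "h holomorphic_on ball c R" unfolding h_def by (intro holomorphic_intros h0)
  have re: "Re (h x) \<le> M" if "x \<in> ball c R" for x
  proof -
    have "exp (Re (h x)) = norm (exp (h x))" by simp
    also have "exp (h x) = g x / g c"
      using h0(2)[of x] h0(2)[of c] that r by (simp add: h_def exp_diff)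
    also have "norm (g x / g c) \<le> exp M"
      using bound[OF that] nz[of c] r by (simp add: norm_divide field_simps)
    finally show ?thesis by simp
  qed
  define \<rho> where "\<rho> = (r + R) / 2"
  define d where "d = (R - r) / 2"
  have d: "d > 0" "\<rho> < R" "\<rho> > 0" using r by (auto simp: d_def \<rho>_def)
  have sub: "dist c w \<le> \<rho>" if "w \<in> cball z d" for w
  proof -
    have "dist c w \<le> dist c z + dist z w" by (rule dist_triangle)
    also have "\<dots> \<le> r + d" using that z by simp
    finally show ?thesis by (simp add: \<rho>_def d_def field_simps)
  qed
  have hb: "norm (h w) \<le> 4 * M * R / (R - r)" if "w \<in> cball z d" for w
  proof -
    have "norm (h w) \<le> 2 * M * \<rho> / (R - \<rho>)"
      by (rule borel_caratheodory[OF h _ re M _ sub[OF that]]) (use d in \<open>auto simp: h_def\<close>)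
    also have "\<dots> = 2 * M * (r + R) / (R - r)" using r by (simp add: \<rho>_def field_simps)
    also have "\<dots> \<le> 4 * M * R / (R - r)" using r M by (intro divide_right_mono) auto
    finally show ?thesis .
  qed
  have cs: "cball z d \<subseteq> ball c R" using sub d by fastforce
  have "norm ((deriv ^^ 1) h z) \<le> fact 1 * (4 * M * R / (R - r)) / d ^ 1"
  proof (rule Cauchy_inequality)
    show "h holomorphic_on ball z d" using h cs by (meson ball_subset_cball holomorphic_on_subset)
    show "continuous_on (cball z d) h"
      using h cs holomorphic_on_imp_continuous_on holomorphic_on_subset by blast
  qed (use d hb in \<open>auto simp: dist_norm\<close>)
  also have "\<dots> = 8 * M * R / (R - r)\<^sup>2"
    using r by (simp add: d_def field_simps power2_eq_square)
  also have "(deriv ^^ 1) h z = deriv g z / g z"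
  proof -
    have zin: "z \<in> ball c R" using z r by simp
    have dh: "(h has_field_derivative deriv h z) (at z)"
      using holomorphic_derivI[OF h open_ball zin] .
    have "((\<lambda>x. exp (h x) * g c) has_field_derivative exp (h z) * deriv h z * g c) (at z)"
      by (auto intro!: derivative_eq_intros dh)
    moreover have eq: "exp (h x) * g c = g x" if "x \<in> ball c R" for x
      using h0(2)[of x] h0(2)[of c] that r nz[of c] by (simp add: h_def exp_diff)
    ultimately have "(g has_field_derivative exp (h z) * deriv h z * g c) (at z)"
      using has_field_derivative_transform_within_open[OF _ open_ball zin] by fastforce
    then have "deriv g z = exp (h z) * deriv h z * g c" by (rule DERIV_imp_deriv)
    also have "\<dots> = deriv h z * g z" using eq[OF zin] by (metis mult.assoc mult.commute)
    finally show ?thesis using nz[OF zin] by simp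
  qed
  finally show ?thesis .
qed

lemma norm_le_exp_logderiv_bound:
  fixes g :: "complex \<Rightarrow> complex"
  assumes hol: "g holomorphic_on S" and S: "open S" "convex S" and nz: "\<And>z. z \<in> S \<Longrightarrow> g z \<noteq> 0"
    and ab: "closed_segment a b \<subseteq> S"
    and bound: "\<And>z. z \<in> closed_segment a b \<Longrightarrow> norm (deriv g z / g z) \<le> K"
  shows "norm (g a) \<le> exp (K * dist a b) * norm (g b)"
proof -
  have aS: "a \<in> S" "b \<in> S" using ab by auto
  obtain h where h: "h holomorphic_on S" "\<And>x. x \<in> S \<Longrightarrow> exp (h x) = g x"
    using holomorphic_logarithm_exists[OF S(2,1) hol nz aS(1)] by auto
  have dh: "(h has_field_derivative deriv g x / g x) (at x)" if x: "x \<in> S" for x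
  proof -
    have dh: "(h has_field_derivative deriv h x) (at x)"
      using holomorphic_derivI[OF h(1) S(1) x] .
    have "((\<lambda>x. exp (h x)) has_field_derivative exp (h x) * deriv h x) (at x)"
      by (auto intro!: derivative_eq_intros dh)
    then have "(g has_field_derivative exp (h x) * deriv h x) (at x)"
      using has_field_derivative_transform_within_open[OF _ S(1) x] h(2) by fastforce
    then have "deriv g x = exp (h x) * deriv h x" by (rule DERIV_imp_deriv)
    then show ?thesis using dh h(2)[OF x] nz[OF x] by simp
  qed
  have "norm (h a - h b) \<le> K * norm (a - b)"
    by (rule field_differentiable_bound[OF convex_closed_segment[of a b]])
       (use dh ab bound in \<open>auto intro: has_field_derivative_at_within\<close>)
  then have "Re (h a) \<le> K * dist a b + Re (h b)"
    using abs_Re_le_cmod[of "h a - h b"] by (simp add: dist_norm)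
  then have "exp (Re (h a)) \<le> exp (K * dist a b) * exp (Re (h b))"
    by (simp flip: exp_add)
  then show ?thesis using h(2)[OF aS(1)] h(2)[OF aS(2)] by (metis norm_exp_eq_Re)
qed

text \<open>The order of vanishing and the cofactor are found on a small ball; away from
  \<open>a\<close> the cofactor is the quotient of \<open>f\<close> by the power. The two agree on
  the overlap and glue.\<close>

lemma holomorphic_factor_zero_global:
  assumes hol: "f holomorphic_on S" and S: "open S" "connected S" and a: "a \<in> S" "f a = 0"
    and nc: "\<not> f constant_on S"
  obtains m g where "m > 0" "g holomorphic_on S" "g a \<noteq> 0" "\<And>w. w \<in> S \<Longrightarrow> f w = (w - a) ^ m * g w"
proof -
  obtain g r m where gr: "0 < m" "0 < r" "ball a r \<subseteq> S" "g holomorphic_on ball a r"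
      "\<And>w. w \<in> ball a r \<Longrightarrow> f w = (w - a) ^ m * g w" "\<And>w. w \<in> ball a r \<Longrightarrow> g w \<noteq> 0"
    using holomorphic_factor_zero_nonconstant[OF hol S a nc] by metis
  define G where "G = (\<lambda>w. if w = a then g a else f w / (w - a) ^ m)"
  have "G holomorphic_on ball a r \<union> (S - {a})"
  proof (intro holomorphic_on_Un)
    have "G w = g w" if "w \<in> ball a r" for w using gr(5)[OF that] by (simp add: G_def)
    then show "G holomorphic_on ball a r" by (intro holomorphic_transform[OF gr(4)]) auto
    have "(\<lambda>w. f w / (w - a) ^ m) holomorphic_on S - {a}"
      by (intro holomorphic_intros holomorphic_on_subset[OF hol]) auto
    then show "G holomorphic_on S - {a}"
      by (rule holomorphic_transform) (auto simp: G_def)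
  qed (use S in \<open>auto intro: open_delete\<close>)
  moreover have "ball a r \<union> (S - {a}) = S" using gr(2,3) by auto
  ultimately have "G holomorphic_on S" by simp
  moreover have "f w = (w - a) ^ m * G w" for w using a gr(1) by (simp add: G_def)
  moreover have "G a \<noteq> 0" using gr(2,6) by (simp add: G_def)
  ultimately show ?thesis using that gr(1) by blast
qed

section \<open>Zeta sums and finite Euler products\<close>

definition real_zeta :: "real \<Rightarrow> real" where
  "real_zeta \<sigma> = (\<Sum>\<^sub>\<infinity>n\<in>{0<..}. real n powr (-\<sigma>))"

text \<open>Discrete form of the comparison of the zeta sum with an integral: the mean value theorem
  for x powr (1 - \<sigma>) on [n, n + 1], in a shape that telescopes.\<close>

lemma powr_telescope_bounds:
  fixes \<sigma> :: real and n :: nat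
  assumes "\<sigma> > 1" "n > 0"
  shows "(\<sigma> - 1) * real (Suc n) powr (-\<sigma>) \<le> real n powr (1 - \<sigma>) - real (Suc n) powr (1 - \<sigma>)"
    and "real n powr (1 - \<sigma>) - real (Suc n) powr (1 - \<sigma>) \<le> (\<sigma> - 1) * real n powr (-\<sigma>)"
proof -
  have "\<exists>z>real n. z < real (Suc n) \<and>
      real (Suc n) powr (1 - \<sigma>) - real n powr (1 - \<sigma>) = (real (Suc n) - real n) * ((1 - \<sigma>) * z powr (1 - \<sigma> - 1))"
    using assms by (intro MVT2) (auto intro!: derivative_eq_intros)
  then obtain z where z: "real n < z" "z < real (Suc n)"
      "real n powr (1 - \<sigma>) - real (Suc n) powr (1 - \<sigma>) = (\<sigma> - 1) * z powr (-\<sigma>)"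
    by (auto simp: algebra_simps)
  have "real (Suc n) powr (-\<sigma>) \<le> z powr (-\<sigma>)" "z powr (-\<sigma>) \<le> real n powr (-\<sigma>)"
    using z assms by (auto intro!: powr_mono2')
  then show "(\<sigma> - 1) * real (Suc n) powr (-\<sigma>) \<le> real n powr (1 - \<sigma>) - real (Suc n) powr (1 - \<sigma>)"
    and "real n powr (1 - \<sigma>) - real (Suc n) powr (1 - \<sigma>) \<le> (\<sigma> - 1) * real n powr (-\<sigma>)"
    using assms unfolding z(3) by (auto intro!: mult_left_mono)
qed

lemma powr_telescope_has_sum:
  fixes \<sigma> :: real and N :: nat
  assumes "\<sigma> > 1" "N > 0"
  shows "((\<lambda>n. real n powr (1 - \<sigma>) - real (Suc n) powr (1 - \<sigma>)) has_sum (real N powr (1 - \<sigma>))) {N..}"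
proof -
  have "((\<lambda>n. real (N + n) powr (1 - \<sigma>)) \<longlongrightarrow> 0) sequentially"
    using assms
    by (intro tendsto_neg_powr filterlim_compose[OF filterlim_real_sequentially])
       (auto simp: filterlim_add_const_nat_at_top add.commute)
  from telescope_sums'[OF this]
  have "(\<lambda>n. real (N + n) powr (1 - \<sigma>) - real (Suc (N + n)) powr (1 - \<sigma>)) sums (real N powr (1 - \<sigma>))"
    by simp
  moreover have "real (N + n) powr (1 - \<sigma>) - real (Suc (N + n)) powr (1 - \<sigma>) \<ge> 0" for n
    using assms by (auto intro!: powr_mono2')
  ultimately have "((\<lambda>n. real (N + n) powr (1 - \<sigma>) - real (Suc (N + n)) powr (1 - \<sigma>)) has_sum (real N powr (1 - \<sigma>))) UNIV"
    by (rule sums_nonneg_imp_has_sum)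
  moreover have "bij_betw (\<lambda>n. N + n) UNIV {N..}"
    by (rule bij_betwI[of _ _ _ "\<lambda>n. n - N"]) auto
  ultimately show ?thesis
    using has_sum_reindex_bij_betw[of "\<lambda>n. N + n" UNIV "{N..}"
        "\<lambda>n. real n powr (1 - \<sigma>) - real (Suc n) powr (1 - \<sigma>)"]
    by simp
qed

lemma powr_telescope_divide_has_sum:
  fixes \<sigma> :: real and N :: nat
  assumes "\<sigma> > 1" "N > 0"
  shows "((\<lambda>n. (real n powr (1 - \<sigma>) - real (Suc n) powr (1 - \<sigma>)) / (\<sigma> - 1)) has_sum
           (real N powr (1 - \<sigma>) / (\<sigma> - 1))) {N..}"
  using has_sum_cmult_left[OF powr_telescope_has_sum[OF assms], of "1 / (\<sigma> - 1)"] by simp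

lemma powr_summable_on_greaterThan:
  fixes \<sigma> :: real
  assumes "\<sigma> > 1"
  shows "(\<lambda>n. real n powr (-\<sigma>)) summable_on {N<..}"
proof -
  have s: "(\<lambda>n. real (Suc n) powr (-\<sigma>)) summable_on {Suc 0..}"
  proof (rule summable_on_comparison_test)
    show "(\<lambda>n. (real n powr (1 - \<sigma>) - real (Suc n) powr (1 - \<sigma>)) / (\<sigma> - 1)) summable_on {Suc 0..}"
      by (rule has_sum_imp_summable, rule powr_telescope_divide_has_sum[OF assms]) simp
  qed (use powr_telescope_bounds(1)[OF assms] assms in \<open>auto simp: pos_le_divide_eq mult.commute\<close>)
  have b: "bij_betw Suc {Suc 0..} {Suc 0<..}"
    by (rule bij_betwI[of _ _ _ "\<lambda>n. n - 1"]) auto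
  have "(\<lambda>n. real n powr (-\<sigma>)) summable_on {Suc 0<..}"
    using s summable_on_reindex_bij_betw[OF b, of "\<lambda>n. real n powr (-\<sigma>)"] by simp
  then have "(\<lambda>n. real n powr (-\<sigma>)) summable_on {Suc 0<..} \<union> {0, Suc 0}"
    by (intro summable_on_union) auto
  then show ?thesis
    by (rule summable_on_subset_banach) auto
qed

lemma infsum_powr_tail_le:
  fixes \<sigma> :: real
  assumes "\<sigma> > 1" "N > 0"
  shows "(\<Sum>\<^sub>\<infinity>n\<in>{N<..}. real n powr (-\<sigma>)) \<le> real N powr (1 - \<sigma>) / (\<sigma> - 1)"
proof -
  have b: "bij_betw Suc {N..} {N<..}"
    by (rule bij_betwI[of _ _ _ "\<lambda>n. n - 1"]) auto
  have "(\<Sum>\<^sub>\<infinity>n\<in>{N<..}. real n powr (-\<sigma>)) = (\<Sum>\<^sub>\<infinity>n\<in>{N..}. real (Suc n) powr (-\<sigma>))"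
    using infsum_reindex_bij_betw[OF b, of "\<lambda>n. real n powr (-\<sigma>)"] by simp
  also have "\<dots> \<le> (\<Sum>\<^sub>\<infinity>n\<in>{N..}. (real n powr (1 - \<sigma>) - real (Suc n) powr (1 - \<sigma>)) / (\<sigma> - 1))"
  proof (rule infsum_mono)
    show "(\<lambda>n. real (Suc n) powr (-\<sigma>)) summable_on {N..}"
      using powr_summable_on_greaterThan[OF assms(1), of N]
        summable_on_reindex_bij_betw[OF b, of "\<lambda>n. real n powr (-\<sigma>)"] by simp
    show "(\<lambda>n. (real n powr (1 - \<sigma>) - real (Suc n) powr (1 - \<sigma>)) / (\<sigma> - 1)) summable_on {N..}"
      by (rule has_sum_imp_summable, rule powr_telescope_divide_has_sum[OF assms])
  qed (use powr_telescope_bounds(1)[OF assms(1)] assms in \<open>auto simp: pos_le_divide_eq mult.commute\<close>)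
  also have "\<dots> = real N powr (1 - \<sigma>) / (\<sigma> - 1)"
    using powr_telescope_divide_has_sum[OF assms] by (rule infsumI)
  finally show ?thesis .
qed

lemma real_zeta_ge:
  assumes "\<sigma> > 1"
  shows "real_zeta \<sigma> \<ge> 1 / (\<sigma> - 1)"
proof -
  have eq: "{0<..} = {Suc 0..}" by auto
  have hs: "((\<lambda>n. (real n powr (1 - \<sigma>) - real (Suc n) powr (1 - \<sigma>)) / (\<sigma> - 1)) has_sum (1 / (\<sigma> - 1))) {Suc 0..}"
    using powr_telescope_divide_has_sum[OF assms, of "Suc 0"] by simp
  have "(\<Sum>\<^sub>\<infinity>n\<in>{Suc 0..}. (real n powr (1 - \<sigma>) - real (Suc n) powr (1 - \<sigma>)) / (\<sigma> - 1)) \<le> real_zeta \<sigma>"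
    unfolding real_zeta_def eq
  proof (rule infsum_mono)
    show "(\<lambda>n. real n powr (-\<sigma>)) summable_on {Suc 0..}"
      using powr_summable_on_greaterThan[OF assms, of 0] by (simp add: eq)
  qed (use has_sum_imp_summable[OF hs] powr_telescope_bounds(2)[OF assms] assms in
      \<open>auto simp: pos_divide_le_eq mult.commute\<close>)
  then show ?thesis using infsumI[OF hs] by simp
qed

lemma real_zeta_le:
  assumes "\<sigma> > 1"
  shows "real_zeta \<sigma> \<le> 1 + 1 / (\<sigma> - 1)"
proof -
  have eq: "{0<..} = {Suc 0} \<union> {Suc 0<..}" by auto
  have "real_zeta \<sigma> = 1 + (\<Sum>\<^sub>\<infinity>n\<in>{Suc 0<..}. real n powr (-\<sigma>))"
    unfolding real_zeta_def eq using powr_summable_on_greaterThan[OF assms]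
    by (subst infsum_Un_disjoint) auto
  then show ?thesis using infsum_powr_tail_le[OF assms, of "Suc 0"] by simp
qed

lemma suc_powr_sums_real_zeta:
  assumes "\<sigma> > 1"
  shows "(\<lambda>n. real (Suc n) powr (-\<sigma>)) sums real_zeta \<sigma>"
proof -
  have b: "bij_betw Suc UNIV {0<..}"
    by (rule bij_betwI[of _ _ _ "\<lambda>n. n - 1"]) auto
  have "((\<lambda>n. real n powr (-\<sigma>)) has_sum real_zeta \<sigma>) {0<..}"
    unfolding real_zeta_def by (intro has_sum_infsum powr_summable_on_greaterThan assms)
  then have "((\<lambda>n. real (Suc n) powr (-\<sigma>)) has_sum real_zeta \<sigma>) UNIV"
    using has_sum_reindex_bij_betw[OF b, of "\<lambda>n. real n powr (-\<sigma>)"] by simp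
  then show ?thesis by (rule has_sum_imp_sums)
qed

text \<open>Sieve of Eratosthenes: the numbers free of primes in \<open>A\<close> are those also
  free of a new prime q, together with q times all numbers free of primes in \<open>A\<close>. Hence
  the factor 1 - f q removes exactly the multiples of q.\<close>

lemma finite_euler_product_mult_infsum:
  fixes f :: "nat \<Rightarrow> 'a::{real_normed_field,banach}"
  assumes mult: "\<And>m n. f (m * n) = f m * f n"
    and summ: "f abs_summable_on {0<..}"
    and "finite A" and "\<And>p. p \<in> A \<Longrightarrow> prime p"
  shows "(\<Prod>p\<in>A. 1 - f p) * infsum f {0<..} = infsum f {n. n > 0 \<and> (\<forall>p\<in>A. \<not> p dvd n)}"
  using assms(3,4)
proof (induction A rule: finite_induct)
  case empty
  have "{n. n > 0} = {0::nat<..}" by auto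
  then show ?case by simp
next
  case (insert q A)
  define S where "S = {n. n > 0 \<and> (\<forall>p\<in>A. \<not> p dvd n)}"
  define T where "T = {n. n > 0 \<and> (\<forall>p\<in>insert q A. \<not> p dvd n)}"
  have q: "prime q" and q0: "q > 0" using insert.prems by (auto simp: prime_gt_0_nat)
  have summ': "f summable_on X" if "X \<subseteq> {0<..}" for X
    using summable_on_subset_banach[OF abs_summable_summable[OF summ] that] .
  have S: "S = T \<union> (\<lambda>n. q * n) ` S"
  proof (intro Set.set_eqI iffI)
    fix n assume n: "n \<in> S"
    show "n \<in> T \<union> (\<lambda>n. q * n) ` S"
    proof (cases "q dvd n")
      case True
      then obtain k where k: "n = q * k" by (elim dvdE)
      have "k \<in> S" using n unfolding S_def k by (auto simp: dvd_mult)
      then show ?thesis using k by blast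
    next
      case False
      then show ?thesis using n by (auto simp: S_def T_def)
    qed
  next
    fix n assume "n \<in> T \<union> (\<lambda>n. q * n) ` S"
    then show "n \<in> S"
    proof
      assume "n \<in> (\<lambda>n. q * n) ` S"
      then obtain k where k: "k \<in> S" "n = q * k" by auto
      have "\<not> p dvd n" if p: "p \<in> A" for p
      proof
        assume "p dvd n"
        moreover have "prime p" using p insert.prems by auto
        ultimately have "p dvd q \<or> p dvd k" using k by (simp add: prime_dvd_mult_iff)
        moreover have "\<not> p dvd k" using k p by (auto simp: S_def)
        ultimately have "p = q" using primes_dvd_imp_eq[OF \<open>prime p\<close> q] by blast
        then show False using p insert.hyps by auto
      qed
      then show ?thesis using k q0 by (auto simp: S_def)
    qed (auto simp: S_def T_def)
  qed
  have sub: "S \<subseteq> {0<..}" "T \<subseteq> {0<..}" "(\<lambda>n. q * n) ` S \<subseteq> {0<..}"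
    using q0 by (auto simp: S_def T_def)
  have "infsum f S = infsum f T + infsum f ((\<lambda>n. q * n) ` S)"
    by (subst S, rule infsum_Un_disjoint) (use sub summ' in \<open>auto simp: T_def\<close>)
  also have "infsum f ((\<lambda>n. q * n) ` S) = f q * infsum f S"
    by (subst infsum_reindex) (use q0 in \<open>auto simp: inj_on_def o_def mult infsum_cmult_right'\<close>)
  finally have "infsum f T = infsum f S - f q * infsum f S" by (metis add_diff_cancel_right')
  then have "infsum f T = (1 - f q) * infsum f S" by (simp add: left_diff_distrib)
  moreover have "(\<Prod>p\<in>A. 1 - f p) * infsum f {0<..} = infsum f S"
    unfolding S_def using insert.prems by (intro insert.IH) auto
  ultimately show ?case using insert.hyps by (simp add: T_def mult.assoc)
qed

text \<open>A number n > 1 without prime factors up to \<open>N\<close> exceeds \<open>N\<close>, so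
  besides the term 1 only a tail of the zeta sum survives. The error depends on \<open>f\<close>
  through \<sigma> alone, which later yields uniformity in s.\<close>

lemma finite_euler_product_mult_infsum_approx:
  fixes f :: "nat \<Rightarrow> 'a::{real_normed_field,banach}"
  assumes mult: "\<And>m n. f (m * n) = f m * f n" and f1: "f 1 = 1"
    and bound: "\<And>n. n > 0 \<Longrightarrow> norm (f n) \<le> real n powr (-\<sigma>)" and \<sigma>: "\<sigma> > 1" and N: "N > 0"
  shows "norm ((\<Prod>p | prime p \<and> p \<le> N. 1 - f p) * infsum f {0<..} - 1) \<le> real N powr (1 - \<sigma>) / (\<sigma> - 1)"
proof -
  have summ: "f abs_summable_on {0<..}"
    by (rule summable_on_comparison_test[OF powr_summable_on_greaterThan[OF \<sigma>]]) (use bound in auto)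
  define T where "T = {n. n > 1 \<and> (\<forall>p. prime p \<and> p \<le> N \<longrightarrow> \<not> p dvd n)}"
  have sT: "f abs_summable_on T"
    by (rule summable_on_subset_banach[OF summ]) (auto simp: T_def)
  have TN: "T \<subseteq> {N<..}"
  proof
    fix n assume n: "n \<in> T"
    then obtain p where p: "prime p" "p dvd n" using prime_factor_nat[of n] by (auto simp: T_def)
    then have "p > N" using n by (auto simp: T_def)
    then show "n \<in> {N<..}" using dvd_imp_le[OF p(2)] n by (auto simp: T_def)
  qed
  have "{n. n > 0 \<and> (\<forall>p\<in>{p. prime p \<and> p \<le> N}. \<not> p dvd n)} = {1} \<union> T"
    by (auto simp: T_def dest: not_prime_unit)
  moreover have "(\<Prod>p | prime p \<and> p \<le> N. 1 - f p) * infsum f {0<..}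
      = infsum f {n. n > 0 \<and> (\<forall>p\<in>{p. prime p \<and> p \<le> N}. \<not> p dvd n)}"
    by (rule finite_euler_product_mult_infsum[OF mult summ]) auto
  ultimately have "(\<Prod>p | prime p \<and> p \<le> N. 1 - f p) * infsum f {0<..} = infsum f ({1} \<union> T)"
    by (rule trans[OF _ arg_cong, rotated])
  also have "\<dots> = 1 + infsum f T"
    using abs_summable_summable[OF sT] f1
    by (subst infsum_Un_disjoint) (auto simp: T_def)
  finally have "norm ((\<Prod>p | prime p \<and> p \<le> N. 1 - f p) * infsum f {0<..} - 1) = norm (infsum f T)"
    by simp
  also have "norm (infsum f T) \<le> (\<Sum>\<^sub>\<infinity>n\<in>T. norm (f n))" by (rule norm_infsum_bound[OF sT])
  also have "\<dots> \<le> (\<Sum>\<^sub>\<infinity>n\<in>{N<..}. real n powr (-\<sigma>))"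
    by (rule infsum_mono_neutral[OF sT powr_summable_on_greaterThan[OF \<sigma>]])
       (use TN bound in \<open>auto simp: T_def\<close>)
  also have "\<dots> \<le> real N powr (1 - \<sigma>) / (\<sigma> - 1)" by (rule infsum_powr_tail_le[OF \<sigma> N])
  finally show ?thesis .
qed

section \<open>Prime sums\<close>

lemma real_zeta_pos: "\<sigma> > 1 \<Longrightarrow> real_zeta \<sigma> > 0"
  using real_zeta_ge[of \<sigma>] by (smt (verit) divide_pos_pos)

lemma powr_div_tendsto_0:
  assumes "\<sigma> > (1::real)"
  shows "(\<lambda>N. real N powr (1 - \<sigma>) / (\<sigma> - 1)) \<longlonglongrightarrow> 0"
proof -
  have "(\<lambda>N. real N powr (1 - \<sigma>)) \<longlonglongrightarrow> 0"
    using assms by (intro tendsto_neg_powr filterlim_real_sequentially) auto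
  from tendsto_divide[OF this tendsto_const, of "\<sigma> - 1"] show ?thesis using assms by simp
qed

lemma prime_powr_less_one:
  assumes "prime p" "t > 0"
  shows "0 < real p powr (-t)" "real p powr (-t) < 1"
  using assms prime_gt_1_nat[of p] by (auto simp: powr_minus_divide gr_one_powr field_simps)

lemma real_euler_product_tendsto:
  assumes "\<sigma> > 1"
  shows "(\<lambda>N. (\<Prod>p | prime p \<and> p \<le> N. 1 - real p powr (-\<sigma>)) * real_zeta \<sigma>) \<longlonglongrightarrow> 1"
proof (rule LIM_zero_cancel, rule Lim_null_comparison[OF _ powr_div_tendsto_0[OF assms]])
  show "eventually (\<lambda>N. norm ((\<Prod>p | prime p \<and> p \<le> N. 1 - real p powr (-\<sigma>)) * real_zeta \<sigma> - 1)
      \<le> real N powr (1 - \<sigma>) / (\<sigma> - 1)) sequentially"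
    using eventually_gt_at_top[of 0]
  proof eventually_elim
    case (elim N)
    then show ?case
      using finite_euler_product_mult_infsum_approx[of "\<lambda>n. real n powr (-\<sigma>)", OF _ _ _ assms elim]
      by (simp add: powr_mult real_zeta_def)
  qed
qed

text \<open>The finite products decrease in \<open>N\<close> and their limit is 1, so each of them
  lies above it.\<close>

lemma real_euler_product_ge:
  assumes "\<sigma> > 1"
  shows "1 \<le> (\<Prod>p | prime p \<and> p \<le> N. 1 - real p powr (-\<sigma>)) * real_zeta \<sigma>"
proof (rule decseq_ge[OF _ real_euler_product_tendsto[OF assms]])
  show "decseq (\<lambda>N. (\<Prod>p | prime p \<and> p \<le> N. 1 - real p powr (-\<sigma>)) * real_zeta \<sigma>)"
  proof (rule decseq_SucI, rule mult_right_mono)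
    fix N :: nat
    define A where "A = {p. prime p \<and> p \<le> N}"
    define B where "B = {p. prime p \<and> p \<le> Suc N}"
    have fin: "finite B" unfolding B_def by simp
    have "(\<Prod>p\<in>B. 1 - real p powr (-\<sigma>)) = (\<Prod>p\<in>B - A. 1 - real p powr (-\<sigma>)) * (\<Prod>p\<in>A. 1 - real p powr (-\<sigma>))"
      using fin by (intro prod.subset_diff) (auto simp: A_def B_def)
    also have "\<dots> \<le> 1 * (\<Prod>p\<in>A. 1 - real p powr (-\<sigma>))"
      using prime_powr_less_one[of _ \<sigma>] assms
      by (intro mult_right_mono prod_le_1 prod_nonneg) (auto simp: A_def B_def less_imp_le)
    finally show "(\<Prod>p | prime p \<and> p \<le> Suc N. 1 - real p powr (-\<sigma>)) \<le> (\<Prod>p | prime p \<and> p \<le> N. 1 - real p powr (-\<sigma>))"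
      by (simp add: A_def B_def)
  qed (use real_zeta_pos[OF assms] in auto)
qed

text \<open>The derivative of ln (1 - x powr (-z)) in z is ln x / (x powr z - 1), which decreases in
  z, so its mean over the interval is at least its value at \<sigma>. For a prime x that value is
  the contribution of x to -\<zeta>'/\<zeta>(\<sigma>).\<close>

lemma ln_one_minus_powr_diff_ge:
  fixes x :: real
  assumes x: "x > 1" and t: "0 < \<tau>" "\<tau> < \<sigma>"
  shows "(\<sigma> - \<tau>) * (ln x / (x powr \<sigma> - 1)) \<le> ln ((1 - x powr (-\<sigma>)) / (1 - x powr (-\<tau>)))"
proof -
  have lt1: "x powr (-t) < 1" if "t > 0" for t
    using that x by (simp add: powr_minus_divide gr_one_powr field_simps)
  have "\<exists>z>\<tau>. z < \<sigma> \<and> ln (1 - x powr (-\<sigma>)) - ln (1 - x powr (-\<tau>))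
      = (\<sigma> - \<tau>) * (ln x * x powr (-z) / (1 - x powr (-z)))"
  proof (rule MVT2[OF t(2)])
    fix z assume z: "\<tau> \<le> z" "z \<le> \<sigma>"
    show "((\<lambda>z. ln (1 - x powr (-z))) has_real_derivative ln x * x powr (-z) / (1 - x powr (-z))) (at z)"
      using lt1[of z] z t x by (auto intro!: derivative_eq_intros)
  qed
  then obtain z where z: "\<tau> < z" "z < \<sigma>" and eq: "ln (1 - x powr (-\<sigma>)) - ln (1 - x powr (-\<tau>))
      = (\<sigma> - \<tau>) * (ln x * x powr (-z) / (1 - x powr (-z)))" by blast
  have pz: "x powr z > 1" using x z t by (simp add: gr_one_powr)
  have "ln x * x powr (-z) / (1 - x powr (-z)) = ln x / (x powr z - 1)"
    using pz by (simp add: powr_minus_divide field_simps)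
  also have "\<dots> \<ge> ln x / (x powr \<sigma> - 1)"
    using pz x z by (intro divide_left_mono mult_pos_pos) (auto simp: powr_mono less_trans[OF pz])
  finally have "(\<sigma> - \<tau>) * (ln x / (x powr \<sigma> - 1)) \<le> ln (1 - x powr (-\<sigma>)) - ln (1 - x powr (-\<tau>))"
    unfolding eq using t by (intro mult_left_mono) auto
  then show ?thesis
    using lt1[of \<sigma>] lt1[of \<tau>] t by (simp add: ln_div)
qed

text \<open>The convexity of \<open>ln \<zeta>\<close> gives a bound for \<open>- \<zeta>' / \<zeta>\<close>
  by a difference quotient; that the constant \<open>2 ln 2\<close> is smaller than \<open>2\<close> is essential when
  excluding double zeros close to \<open>1\<close>.\<close>

lemma sum_prime_logderiv_le:
  assumes "\<sigma> > 1"
  shows "(\<Sum>p | prime p \<and> p \<le> N. ln (real p) / (real p powr \<sigma> - 1)) \<le> 2 * ln 2 / (\<sigma> - 1) + 1"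
proof -
  \<comment> \<open>At the midpoint of 1 and \<sigma> the quotient \<zeta>(\<tau>)/\<zeta>(\<sigma>)
    is at most 2 (1 + (\<sigma> - 1)/2); dividing its logarithm by \<sigma> - \<tau> = (\<sigma> -
    1)/2 produces the stated constants.\<close>
  define \<tau> where "\<tau> = (1 + \<sigma>) / 2"
  have \<tau>: "1 < \<tau>" "\<tau> < \<sigma>" "\<sigma> - \<tau> = (\<sigma> - 1) / 2" "\<tau> - 1 = (\<sigma> - 1) / 2" using assms by (auto simp: \<tau>_def field_simps)
  define u where "u = (\<lambda>p. (1 - real p powr (-\<sigma>)) / (1 - real p powr (-\<tau>)))"
  define a where "a = (\<lambda>N. \<Prod>p | prime p \<and> p \<le> N. u p)"
  have u1: "u p \<ge> 1" if "prime p" for p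
    using prime_powr_less_one[OF that, of \<sigma>] prime_powr_less_one[OF that, of \<tau>] assms \<tau> prime_gt_1_nat[OF that]
    by (simp add: u_def pos_le_divide_eq powr_mono)
  have "(\<lambda>N. ((\<Prod>p | prime p \<and> p \<le> N. 1 - real p powr (-\<sigma>)) * real_zeta \<sigma>) /
             ((\<Prod>p | prime p \<and> p \<le> N. 1 - real p powr (-\<tau>)) * real_zeta \<tau>) * (real_zeta \<tau> / real_zeta \<sigma>))
        \<longlonglongrightarrow> 1 / 1 * (real_zeta \<tau> / real_zeta \<sigma>)"
    by (intro tendsto_intros real_euler_product_tendsto assms \<tau>) auto
  moreover have "((\<Prod>p | prime p \<and> p \<le> N. 1 - real p powr (-\<sigma>)) * real_zeta \<sigma>) /
             ((\<Prod>p | prime p \<and> p \<le> N. 1 - real p powr (-\<tau>)) * real_zeta \<tau>) * (real_zeta \<tau> / real_zeta \<sigma>) = a N" for N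
    using real_zeta_pos[OF assms] real_zeta_pos[OF \<tau>(1)] by (simp add: a_def u_def prod_dividef)
  ultimately have lim: "a \<longlonglongrightarrow> real_zeta \<tau> / real_zeta \<sigma>" by simp
  have "incseq a"
    unfolding a_def by (intro incseq_SucI prod_mono2) (use u1 in \<open>auto intro: order.trans[OF zero_le_one]\<close>)
  then have aN: "a N \<le> real_zeta \<tau> / real_zeta \<sigma>" using lim by (rule incseq_le)
  have "(\<sigma> - 1) / 2 * (\<Sum>p | prime p \<and> p \<le> N. ln (real p) / (real p powr \<sigma> - 1))
     \<le> (\<Sum>p | prime p \<and> p \<le> N. ln (u p))"
    unfolding sum_distrib_left \<tau>(3)[symmetric] u_def
    by (intro sum_mono ln_one_minus_powr_diff_ge) (use \<tau> prime_gt_1_nat in auto)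
  also have "\<dots> = ln (a N)"
  proof -
    have "u p \<noteq> 0" if "prime p" for p using u1[OF that] by auto
    then show ?thesis unfolding a_def by (intro ln_prod[symmetric]) auto
  qed
  also have "\<dots> \<le> ln (real_zeta \<tau> / real_zeta \<sigma>)"
    using aN u1 unfolding a_def
    by (intro ln_mono) (auto intro!: prod_pos intro: less_le_trans[OF zero_less_one])
  also have "\<dots> \<le> ln ((1 + 1 / (\<tau> - 1)) / (1 / (\<sigma> - 1)))"
    using real_zeta_pos[OF assms] real_zeta_pos[OF \<tau>(1)] real_zeta_ge[OF assms] real_zeta_le[OF \<tau>(1)] assms \<tau>(1)
    by (intro ln_mono frac_le divide_pos_pos) auto
  also have "(1 + 1 / (\<tau> - 1)) / (1 / (\<sigma> - 1)) = 2 * (1 + (\<sigma> - 1) / 2)"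
    using assms by (simp add: \<tau>(4) field_simps)
  also have "ln \<dots> = ln 2 + ln (1 + (\<sigma> - 1) / 2)" using assms by (intro ln_mult_pos add_pos_pos) auto
  also have "\<dots> \<le> ln 2 + (\<sigma> - 1) / 2" using assms by (intro add_left_mono ln_add_one_self_le_self) auto
  finally show ?thesis using assms by (simp add: field_simps)
qed

text \<open>Since x \<le> - ln (1 - x), the sum is at most the logarithm of a finite Euler product,
  and such products stay below \<zeta>(\<sigma>).\<close>

lemma sum_prime_powr_le:
  assumes "\<sigma> > 1"
  shows "(\<Sum>p | prime p \<and> p \<le> N. real p powr (-\<sigma>)) \<le> ln (1 + 1 / (\<sigma> - 1))"
proof -
  define q where "q = (\<Prod>p | prime p \<and> p \<le> N. 1 - real p powr (-\<sigma>))"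
  have pos: "1 - real p powr (-\<sigma>) > 0" if "prime p" for p
    using prime_powr_less_one[OF that, of \<sigma>] assms by simp
  have q: "q > 0" unfolding q_def using pos by (intro prod_pos) auto
  have "(\<Sum>p | prime p \<and> p \<le> N. real p powr (-\<sigma>)) \<le> (\<Sum>p | prime p \<and> p \<le> N. - ln (1 - real p powr (-\<sigma>)))"
  proof (rule sum_mono)
    fix p assume "p \<in> {p. prime p \<and> p \<le> N}"
    then have "0 < 1 - real p powr (-\<sigma>)" using pos by auto
    from ln_le_minus_one[OF this] show "real p powr (-\<sigma>) \<le> - ln (1 - real p powr (-\<sigma>))" by simp
  qed
  also have "\<dots> = ln (1 / q)"
    using pos q by (subst ln_div) (auto simp: q_def sum_negf less_imp_neq[symmetric] intro!: ln_prod[symmetric])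
  also have "1 / q \<le> 1 + 1 / (\<sigma> - 1)"
    using real_euler_product_ge[OF assms, of N] real_zeta_le[OF assms] q
    by (simp add: q_def[symmetric] pos_divide_le_eq) (smt (verit) mult.commute mult_left_mono)
  then have "ln (1 / q) \<le> ln (1 + 1 / (\<sigma> - 1))" using q by (intro ln_mono) auto
  finally show ?thesis .
qed

text \<open>For p \<le> y the condition \<delta> ln y \<le> 1 keeps p powr \<delta> below e, so each
  difference is at most \<delta> ln p / p, hence at most e \<delta> times a term of the sum in
  \<open>sum_prime_logderiv_le\<close>. The factor \<delta> cancels the 1/\<delta> in that bound,
  and 3 covers 2 ln 2 + \<delta>.\<close>

lemma sum_prime_reciprocal_diff_le:
  fixes y \<delta> :: real
  assumes y: "y \<ge> 1" and \<delta>: "0 < \<delta>" "\<delta> \<le> 1" "\<delta> * ln y \<le> 1"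
  shows "(\<Sum>p | prime p \<and> real p \<le> y. 1 / real p - real p powr (-(1 + \<delta>))) \<le> 3 * exp 1"
proof -
  have eq: "{p. prime p \<and> real p \<le> y} = {p. prime p \<and> p \<le> nat \<lfloor>y\<rfloor>}"
    using y by (auto simp: le_nat_floor le_floor_iff nat_le_iff le_nat_iff)
  have "(\<Sum>p | prime p \<and> real p \<le> y. 1 / real p - real p powr (-(1 + \<delta>)))
    \<le> (\<Sum>p | prime p \<and> real p \<le> y. \<delta> * exp 1 * (ln (real p) / (real p powr (1 + \<delta>) - 1)))"
  proof (rule sum_mono)
    fix p assume "p \<in> {p. prime p \<and> real p \<le> y}"
    then have p: "prime p" "real p \<le> y" "real p > 1" using prime_gt_1_nat[of p] by auto
    define v where "v = real p powr \<delta>"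
    have v: "v = exp (\<delta> * ln (real p))" using p by (simp add: v_def powr_def)
    have "\<delta> * ln (real p) \<le> \<delta> * ln y" using p \<delta> by (intro mult_left_mono) auto
    then have "\<delta> * ln (real p) \<le> 1" using \<delta>(3) by linarith
    then have ve: "v \<le> exp 1" unfolding v by simp
    have v1: "v > 1" using p \<delta> by (simp add: v_def gr_one_powr)
    have pv: "real p powr (1 + \<delta>) = real p * v" using p by (simp add: v_def powr_add)
    have "1 - \<delta> * ln (real p) \<le> 1 / v"
      using exp_ge_add_one_self[of "- (\<delta> * ln (real p))"] by (simp add: v exp_minus divide_inverse)
    then have "(1 - 1 / v) / real p \<le> \<delta> * ln (real p) / real p"
      using p by (intro divide_right_mono) auto
    then have "1 / real p - 1 / (real p * v) \<le> \<delta> * ln (real p) / real p"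
      by (simp add: diff_divide_distrib mult.commute)
    also have "\<dots> \<le> \<delta> * ln (real p) * (exp 1 / (real p * v - 1))"
    proof -
      have "1 / real p \<le> exp 1 / (real p * v - 1)"
      proof -
        have h: "real p * v \<le> real p * exp 1" using ve p by (intro mult_left_mono) auto
        have h': "real p * v > 1" using p v1 by (smt (verit) mult_le_cancel_left1)
        have "1 / real p = exp 1 / (real p * exp 1)" by simp
        also have "\<dots> \<le> exp 1 / (real p * v - 1)"
          using p h' by (intro divide_left_mono mult_pos_pos order.trans[OF _ h]) auto
        finally show ?thesis .
      qed
      from mult_left_mono[OF this, of "\<delta> * ln (real p)"] show ?thesis using p \<delta> by simp
    qed
    finally show "1 / real p - real p powr (-(1 + \<delta>)) \<le> \<delta> * exp 1 * (ln (real p) / (real p powr (1 + \<delta>) - 1))"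
      unfolding powr_minus_divide pv by (simp add: mult_ac)
  qed
  also have "\<dots> = \<delta> * exp 1 * (\<Sum>p | prime p \<and> p \<le> nat \<lfloor>y\<rfloor>. ln (real p) / (real p powr (1 + \<delta>) - 1))"
    unfolding eq by (simp add: sum_distrib_left)
  also have "\<dots> \<le> \<delta> * exp 1 * (2 * ln 2 / (1 + \<delta> - 1) + 1)"
    using \<delta> by (intro mult_left_mono sum_prime_logderiv_le) auto
  also have "\<dots> = (2 * ln 2 + \<delta>) * exp 1" using \<delta> by (simp add: field_simps)
  also have "\<dots> \<le> 3 * exp 1" using \<delta> ln_2_less_1 by (intro mult_right_mono) auto
  finally show ?thesis .
qed

text \<open>Rankin's device: on p > y the factor ln p / ln y is at least 1, and inserting it turns
  the tail into a part of the sum in \<open>sum_prime_logderiv_le\<close>.\<close>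

lemma sum_prime_powr_tail_le:
  fixes y \<delta> :: real
  assumes y: "y > 1" and \<delta>: "0 < \<delta>"
  shows "(\<Sum>p | prime p \<and> y < real p \<and> p \<le> N. real p powr (-(1 + \<delta>))) \<le> (2 / \<delta> + 1) / ln y"
proof -
  have "(\<Sum>p | prime p \<and> y < real p \<and> p \<le> N. real p powr (-(1 + \<delta>)))
    \<le> (\<Sum>p | prime p \<and> y < real p \<and> p \<le> N. 1 / ln y * (ln (real p) / (real p powr (1 + \<delta>) - 1)))"
  proof (rule sum_mono)
    fix p assume "p \<in> {p. prime p \<and> y < real p \<and> p \<le> N}"
    then have p: "prime p" "y < real p" "real p > 1" using prime_gt_1_nat[of p] by auto
    have g: "real p powr (1 + \<delta>) > 1" using p \<delta> by (simp add: gr_one_powr)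
    have "real p powr (-(1 + \<delta>)) \<le> 1 / (real p powr (1 + \<delta>) - 1)"
      unfolding powr_minus_divide using g p by (intro divide_left_mono mult_pos_pos) auto
    also have "\<dots> \<le> ln (real p) / ln y * (1 / (real p powr (1 + \<delta>) - 1))"
      using g p y mult_right_mono[of 1 "ln (real p) / ln y" "1 / (real p powr (1 + \<delta>) - 1)"] by simp
    finally show "real p powr (-(1 + \<delta>)) \<le> 1 / ln y * (ln (real p) / (real p powr (1 + \<delta>) - 1))"
      by simp
  qed
  also have "\<dots> \<le> (\<Sum>p | prime p \<and> p \<le> N. 1 / ln y * (ln (real p) / (real p powr (1 + \<delta>) - 1)))"
  proof (rule sum_mono2)
    fix p assume "p \<in> {p. prime p \<and> p \<le> N} - {p. prime p \<and> y < real p \<and> p \<le> N}"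
    then have p: "real p > 1" using prime_gt_1_nat[of p] by auto
    then have g: "real p powr (1 + \<delta>) > 1" using \<delta> by (simp add: gr_one_powr)
    show "0 \<le> 1 / ln y * (ln (real p) / (real p powr (1 + \<delta>) - 1))"
      using p g y by simp
  qed auto
  also have "\<dots> = 1 / ln y * (\<Sum>p | prime p \<and> p \<le> N. ln (real p) / (real p powr (1 + \<delta>) - 1))"
    by (simp add: sum_distrib_left)
  also have "\<dots> \<le> 1 / ln y * (2 * ln 2 / (1 + \<delta> - 1) + 1)"
    using y \<delta> by (intro mult_left_mono sum_prime_logderiv_le) auto
  also have "\<dots> \<le> 1 / ln y * (2 / \<delta> + 1)"
    using y \<delta> ln_2_less_1 by (intro mult_left_mono add_right_mono) (auto intro!: divide_right_mono)
  finally show ?thesis by simp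
qed

section \<open>Dirichlet L-functions in the right half-plane\<close>

lemma norm_powr_diff_le:
  assumes "Re s > -1"
  shows "norm (of_nat (Suc n) powr (-s) - of_nat (Suc (Suc n)) powr (-s)) \<le> norm s * real (Suc n) powr (-(1 + Re s))"
proof -
  let ?S = "closed_segment (of_nat (Suc n)) (of_nat (Suc (Suc n))) :: complex set"
  have S: "z \<in> \<real> \<and> Re z \<ge> real (Suc n)" if "z \<in> ?S" for z
    using that
    by (auto simp: closed_segment_def scaleR_conv_of_real complex_is_Real_iff algebra_simps)
  have "norm (of_nat (Suc n) powr (-s) - of_nat (Suc (Suc n)) powr (-s))
      \<le> (norm s * real (Suc n) powr (-(1 + Re s))) * norm (of_nat (Suc n) - of_nat (Suc (Suc n)) :: complex)"
  proof (rule field_differentiable_bound[where S = ?S and f = "\<lambda>z. z powr (-s)" and f' = "\<lambda>z. (-s) * z powr (-s - 1)"])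
    fix z assume z: "z \<in> ?S"
    have "Re z > 0" using S[OF z] by simp
    then have "z \<notin> \<real>\<^sub>\<le>\<^sub>0" by (auto simp: complex_nonpos_Reals_iff)
    then show "((\<lambda>z. z powr (-s)) has_field_derivative (-s) * z powr (-s - 1)) (at z within ?S)"
      by (rule has_field_derivative_at_within[OF has_field_derivative_powr])
    have "norm (z powr (-s - 1)) = Re z powr Re (-s - 1)"
      using S[OF z] by (intro norm_powr_real_powr) auto
    also have "Re (-s - 1) = -(1 + Re s)" by simp
    also have "Re z powr (-(1 + Re s)) \<le> real (Suc n) powr (-(1 + Re s))"
      using S[OF z] assms by (intro powr_mono2') auto
    finally show "norm ((-s) * z powr (-s - 1)) \<le> norm s * real (Suc n) powr (-(1 + Re s))"
      by (simp add: norm_mult mult_left_mono)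
  qed auto
  then show ?thesis by simp
qed

section \<open>Elementary properties of a nonprincipal character\<close>

locale nonprincipal_character =
  fixes D :: nat and chi :: "nat \<Rightarrow> complex"
  assumes char: "dirichlet_character D chi"
    and nonprincipal: "\<exists>a. coprime a D \<and> chi a \<noteq> 1"
begin

lemma D_pos: "D > 0"
  and chi_mult: "chi (m * n) = chi m * chi n"
  and chi_add_D: "chi (n + D) = chi n"
  and chi_nonzero_iff: "chi n \<noteq> 0 \<longleftrightarrow> coprime n D"
  using char unfolding dirichlet_character_def by blast+

lemma chi_1: "chi 1 = 1"
  using chi_mult[of 1 1] chi_nonzero_iff[of 1] by simp

lemma chi_mod: "chi (n mod D) = chi n"
proof -
  have "chi (k + D * m) = chi k" for k m
    by (induction m) (use chi_add_D in \<open>auto simp: add.assoc[symmetric] add.commute[of D]\<close>)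
  from this[of "n mod D" "n div D"] show ?thesis by simp
qed

lemma chi_power: "chi (n ^ k) = chi n ^ k"
  by (induction k) (use chi_1 in \<open>auto simp: chi_mult\<close>)

lemma norm_chi_le: "norm (chi n) \<le> 1"
proof (cases "coprime n D")
  case True
  then have "[n ^ totient D = 1] (mod D)" by (rule euler_theorem)
  then have "chi (n ^ totient D) = chi 1" by (metis cong_def chi_mod)
  then have "chi n ^ totient D = 1" unfolding chi_power chi_1 .
  then have "norm (chi n) ^ totient D = 1" by (metis norm_power norm_one)
  then have "norm (chi n) = 1"
    using D_pos power_eq_imp_eq_base[of "norm (chi n)" "totient D" 1] by simp
  then show ?thesis by simp
next
  case False
  then have "chi n = 0" using chi_nonzero_iff by blast
  then show ?thesis by simp
qed

text \<open>Multiplication by an \<open>a\<close> with chi a different from 0 and 1 permutes the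
  residues, so the sum equals chi a times itself.\<close>

lemma sum_chi_period: "(\<Sum>n<D. chi n) = 0"
proof -
  obtain a where a: "coprime a D" "chi a \<noteq> 1" using nonprincipal by blast
  have "bij_betw (\<lambda>n. a * n mod D) {..<D} {..<D}"
    unfolding bij_betw_def
  proof (rule conjI)
    show inj: "inj_on (\<lambda>n. a * n mod D) {..<D}"
    proof (rule inj_onI)
      fix x y assume xy: "x \<in> {..<D}" "y \<in> {..<D}" "a * x mod D = a * y mod D"
      then have "[a * x = a * y] (mod D)" by (simp add: cong_def)
      then have "[x = y] (mod D)" using a by (simp add: cong_mult_lcancel_nat)
      then show "x = y" using xy by (simp add: cong_def)
    qed
    show "(\<lambda>n. a * n mod D) ` {..<D} = {..<D}"
      by (rule endo_inj_surj[OF _ _ inj]) (use D_pos in auto)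
  qed
  then have "(\<Sum>n<D. chi n) = (\<Sum>n<D. chi (a * n mod D))"
    using sum.reindex_bij_betw[of "\<lambda>n. a * n mod D" "{..<D}" "{..<D}" chi] by simp
  also have "\<dots> = chi a * (\<Sum>n<D. chi n)"
    by (simp add: chi_mod chi_mult sum_distrib_left)
  finally have "(1 - chi a) * (\<Sum>n<D. chi n) = 0" by (simp add: left_diff_distrib)
  then show ?thesis using a by simp
qed

section \<open>Summation by parts and holomorphy in Re s > 0\<close>

definition partial_chi :: "nat \<Rightarrow> complex" where
  "partial_chi N = (\<Sum>n<N. chi (Suc n))"

text \<open>Complete periods sum to zero, so only an incomplete one contributes. The bound is crude,
  but \<open>D\<close> enters the later estimates only through ln D.\<close>

lemma norm_partial_chi_le: "norm (partial_chi N) \<le> real D"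
proof -
  have per: "partial_chi D = 0"
  proof -
    have "(\<Sum>n<Suc D. chi n) = chi 0 + partial_chi D"
      unfolding partial_chi_def by (rule sum.lessThan_Suc_shift)
    moreover have "(\<Sum>n<Suc D. chi n) = chi 0"
      using sum_chi_period chi_add_D[of 0] by simp
    ultimately show ?thesis by simp
  qed
  have add: "partial_chi (N + D) = partial_chi N" for N
  proof (induction N)
    case 0
    then show ?case using per by (simp add: partial_chi_def)
  next
    case (Suc N)
    then show ?case using chi_add_D[of "Suc N"] by (simp add: partial_chi_def)
  qed
  have "partial_chi (r + D * q) = partial_chi r" for r q
    by (induction q) (use add in \<open>auto simp: add.assoc[symmetric] add.commute[of D]\<close>)
  from this[of "N mod D" "N div D"] have "partial_chi N = partial_chi (N mod D)" by simp
  also have "norm \<dots> \<le> (\<Sum>n<N mod D. 1)"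
    unfolding partial_chi_def by (rule sum_norm_le) (rule norm_chi_le)
  also have "\<dots> \<le> real D" using D_pos by (simp add: less_imp_le)
  finally show ?thesis .
qed

text \<open>The term after summation by parts. Consecutive powers differ by O(n powr (-(1 + Re s)))
  for fixed s, so this series converges absolutely and locally uniformly in Re s > 0, where the
  original one is only known to converge in order.\<close>

definition abel_term :: "complex \<Rightarrow> nat \<Rightarrow> complex" where
  "abel_term s n = partial_chi (Suc n) * (of_nat (Suc n) powr (-s) - of_nat (Suc (Suc n)) powr (-s))"

lemma partial_sum_eq_abel:
  "(\<Sum>n<N. chi (Suc n) * of_nat (Suc n) powr (-s))
     = partial_chi N * of_nat (Suc N) powr (-s) + (\<Sum>n<N. abel_term s n)"
proof (induction N)
  case 0
  then show ?case by (simp add: partial_chi_def)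
next
  case (Suc N)
  have "partial_chi (Suc N) = partial_chi N + chi (Suc N)" by (simp add: partial_chi_def)
  then show ?case
    unfolding sum.lessThan_Suc Suc.IH abel_term_def by (simp add: algebra_simps del: of_nat_Suc)
qed

lemma norm_abel_term_le:
  assumes "Re s > -1"
  shows "norm (abel_term s n) \<le> real D * norm s * real (Suc n) powr (-(1 + Re s))"
proof -
  have "norm (abel_term s n) \<le> real D * (norm s * real (Suc n) powr (-(1 + Re s)))"
    unfolding abel_term_def norm_mult
    by (intro mult_mono norm_partial_chi_le norm_powr_diff_le assms) auto
  then show ?thesis by (simp add: mult.assoc)
qed

lemma abel_term_summable:
  assumes "Re s > 0"
  shows "summable (abel_term s)"
proof (rule summable_comparison_test')
  show "summable (\<lambda>n. real D * norm s * real (Suc n) powr (-(1 + Re s)))"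
    using suc_powr_sums_real_zeta[of "1 + Re s"] assms by (intro summable_mult) (auto simp: sums_iff)
qed (use norm_abel_term_le assms in auto)

lemma dirichlet_L_sums:
  assumes "Re s > 0"
  shows "(\<lambda>n. chi (Suc n) * of_nat (Suc n) powr (-s)) sums (\<Sum>n. abel_term s n)"
  unfolding sums_def partial_sum_eq_abel
proof -
  have "(\<lambda>N. partial_chi N * of_nat (Suc N) powr (-s)) \<longlonglongrightarrow> 0"
  proof (rule Lim_null_comparison)
    show "eventually (\<lambda>N. norm (partial_chi N * of_nat (Suc N) powr (-s)) \<le> real D * real (Suc N) powr (- Re s)) sequentially"
    proof (rule always_eventually, rule allI)
      fix N
      have "norm (of_nat (Suc N) powr (-s) :: complex) = real (Suc N) powr (- Re s)"
        by (subst norm_powr_real_powr) auto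
      then show "norm (partial_chi N * of_nat (Suc N) powr (-s)) \<le> real D * real (Suc N) powr (- Re s)"
        unfolding norm_mult using norm_partial_chi_le[of N] by (simp add: mult_right_mono)
    qed
    have "(\<lambda>N. real (Suc N) powr (- Re s)) \<longlonglongrightarrow> 0"
      using assms by (intro tendsto_neg_powr filterlim_compose[OF filterlim_real_sequentially] filterlim_Suc) auto
    from tendsto_mult[OF tendsto_const this, of "real D"]
    show "(\<lambda>N. real D * real (Suc N) powr (- Re s)) \<longlonglongrightarrow> 0" by simp
  qed
  from tendsto_add[OF this summable_LIMSEQ[OF abel_term_summable[OF assms]]]
  show "(\<lambda>N. partial_chi N * of_nat (Suc N) powr (-s) + (\<Sum>n<N. abel_term s n)) \<longlonglongrightarrow> (\<Sum>n. abel_term s n)"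
    by simp
qed

lemma dirichlet_L_eq_abel:
  assumes "Re s > 0"
  shows "dirichlet_L chi s = (\<Sum>n. abel_term s n)"
  using dirichlet_L_sums[OF assms] unfolding dirichlet_L_def by (simp add: sums_iff)

lemma norm_dirichlet_L_le:
  assumes "Re s > 0"
  shows "norm (dirichlet_L chi s) \<le> real D * norm s * (1 + 1 / Re s)"
proof -
  have z: "(\<lambda>n. real D * norm s * real (Suc n) powr (-(1 + Re s))) sums (real D * norm s * real_zeta (1 + Re s))"
    using assms by (intro sums_mult suc_powr_sums_real_zeta) auto
  have "norm (dirichlet_L chi s) \<le> (\<Sum>n. real D * norm s * real (Suc n) powr (-(1 + Re s)))"
    unfolding dirichlet_L_eq_abel[OF assms]
    by (rule norm_suminf_le) (use norm_abel_term_le assms z in \<open>auto simp: sums_iff\<close>)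
  also have "\<dots> = real D * norm s * real_zeta (1 + Re s)" using z by (simp add: sums_iff)
  also have "\<dots> \<le> real D * norm s * (1 + 1 / Re s)"
    using real_zeta_le[of "1 + Re s"] assms by (intro mult_left_mono) auto
  finally show ?thesis .
qed

lemma abel_term_holomorphic: "(\<lambda>s. abel_term s n) holomorphic_on A"
  unfolding abel_term_def powr_def of_nat_eq_0_iff
  by (simp del: of_nat_Suc) (intro holomorphic_intros)

lemma dirichlet_L_holomorphic: "dirichlet_L chi holomorphic_on {s. Re s > 0}"
proof (rule holomorphic_uniform_sequence[where f = "\<lambda>N s. \<Sum>n<N. abel_term s n"])
  show "open {s. Re s > 0}" by (rule open_halfspace_Re_gt)
  show "(\<lambda>s. \<Sum>n<N. abel_term s n) holomorphic_on {s. Re s > 0}" for N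
    by (intro holomorphic_intros abel_term_holomorphic)
  fix x :: complex assume "x \<in> {s. Re s > 0}"
  then have x: "Re x > 0" by simp
  define d where "d = Re x / 2"
  have d: "d > 0" using x by (simp add: d_def)
  have Re: "Re y \<ge> d" and ny: "norm y \<le> norm x + d" if "y \<in> cball x d" for y
  proof -
    have "norm (x - y) \<le> d" using that by (simp add: dist_norm)
    then show "Re y \<ge> d" "norm y \<le> norm x + d"
      using abs_Re_le_cmod[of "x - y"] norm_triangle_ineq4[of x "x - y"] by (auto simp: d_def)
  qed
  have "uniform_limit (cball x d) (\<lambda>N s. \<Sum>n<N. abel_term s n) (\<lambda>s. \<Sum>n. abel_term s n) sequentially"
  proof (rule Weierstrass_m_test)
    fix n y assume y: "y \<in> cball x d"
    have "norm (abel_term y n) \<le> real D * norm y * real (Suc n) powr (-(1 + Re y))"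
      using Re[OF y] d by (intro norm_abel_term_le) auto
    also have "\<dots> \<le> real D * (norm x + d) * real (Suc n) powr (-(1 + d))"
      using Re[OF y] ny[OF y] d by (intro mult_mono powr_mono) auto
    finally show "norm (abel_term y n) \<le> real D * (norm x + d) * real (Suc n) powr (-(1 + d))" .
  next
    show "summable (\<lambda>n. real D * (norm x + d) * real (Suc n) powr (-(1 + d)))"
      using suc_powr_sums_real_zeta[of "1 + d"] d by (intro summable_mult) (auto simp: sums_iff)
  qed
  then have "uniform_limit (cball x d) (\<lambda>N s. \<Sum>n<N. abel_term s n) (dirichlet_L chi) sequentially"
    by (rule uniform_limit_cong'[THEN iffD1, rotated -1]) (use Re d dirichlet_L_eq_abel in \<open>force+\<close>)
  then show "\<exists>d>0. cball x d \<subseteq> {s. Re s > 0} \<and>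
      uniform_limit (cball x d) (\<lambda>N s. \<Sum>n<N. abel_term s n) (dirichlet_L chi) sequentially"
    using d Re by (intro exI[of _ d]) force
qed

section \<open>Euler product for Re s > 1, through the reciprocals of its finite products\<close>

definition euler_factors :: "nat \<Rightarrow> complex \<Rightarrow> complex" where
  "euler_factors N s = (\<Prod>p | prime p \<and> p \<le> N. 1 - chi p * of_nat p powr (-s))"

lemma norm_chi_powr_le: "norm (chi n * of_nat n powr (-s)) \<le> real n powr (- Re s)"
proof -
  have "norm (of_nat n powr (-s) :: complex) = real n powr (- Re s)"
    by (subst norm_powr_real_powr) auto
  then show ?thesis
    using norm_chi_le[of n] by (simp add: norm_mult mult_left_le_one_le)
qed

lemma dirichlet_L_eq_infsum:
  assumes "Re s > 1"
  shows "dirichlet_L chi s = (\<Sum>\<^sub>\<infinity>n\<in>{0<..}. chi n * of_nat n powr (-s))"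
proof -
  have b: "bij_betw Suc UNIV {0<..}"
    by (rule bij_betwI[of _ _ _ "\<lambda>n. n - 1"]) auto
  have "(\<lambda>n. norm (chi n * of_nat n powr (-s))) summable_on {0<..}"
    by (rule summable_on_comparison_test[OF powr_summable_on_greaterThan[OF assms]])
       (use norm_chi_powr_le in auto)
  then have "((\<lambda>n. chi n * of_nat n powr (-s)) has_sum (\<Sum>\<^sub>\<infinity>n\<in>{0<..}. chi n * of_nat n powr (-s))) {0<..}"
    by (rule has_sum_infsum[OF abs_summable_summable])
  then have "((\<lambda>n. chi (Suc n) * of_nat (Suc n) powr (-s)) has_sum (\<Sum>\<^sub>\<infinity>n\<in>{0<..}. chi n * of_nat n powr (-s))) UNIV"
    using has_sum_reindex_bij_betw[OF b, of "\<lambda>n. chi n * of_nat n powr (-s)"] by simp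
  then have "(\<lambda>n. chi (Suc n) * of_nat (Suc n) powr (-s)) sums (\<Sum>\<^sub>\<infinity>n\<in>{0<..}. chi n * of_nat n powr (-s))"
    by (rule has_sum_imp_sums)
  then show ?thesis unfolding dirichlet_L_def by (rule sums_unique[symmetric])
qed

lemma euler_factors_mult_dirichlet_L:
  assumes "\<sigma> > 1" "Re s \<ge> \<sigma>" "N > 0"
  shows "norm (euler_factors N s * dirichlet_L chi s - 1) \<le> real N powr (1 - \<sigma>) / (\<sigma> - 1)"
proof -
  have "Re s > 1" using assms by simp
  show ?thesis
    unfolding dirichlet_L_eq_infsum[OF \<open>Re s > 1\<close>] euler_factors_def
  proof (rule finite_euler_product_mult_infsum_approx)
    show "chi (m * n) * of_nat (m * n) powr (-s) = (chi m * of_nat m powr (-s)) * (chi n * of_nat n powr (-s))" for m n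
      by (simp add: chi_mult powr_times_real)
    show "chi 1 * of_nat 1 powr (-s) = 1" using chi_1 by simp
    fix n :: nat assume "n > 0"
    then have "real n powr (- Re s) \<le> real n powr (-\<sigma>)" using assms by (intro powr_mono) auto
    then show "norm (chi n * of_nat n powr (-s)) \<le> real n powr (-\<sigma>)"
      using norm_chi_powr_le[of n s] by simp
  qed (use assms in auto)
qed

text \<open>Uniformity on an open half-plane, rather than pointwise convergence, lets the
  derivatives converge too; the estimate of L'/L rests on that.\<close>

lemma euler_factors_mult_dirichlet_L_uniform:
  assumes "\<sigma> > 1"
  shows "uniform_limit {s. Re s > \<sigma>} (\<lambda>N s. euler_factors N s * dirichlet_L chi s) (\<lambda>_. 1) sequentially"
proof (rule uniform_limitI)
  fix e :: real assume "e > 0"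
  then have "eventually (\<lambda>N. real N powr (1 - \<sigma>) / (\<sigma> - 1) < e) sequentially"
    using powr_div_tendsto_0[OF assms] by (rule order_tendstoD(2)[rotated])
  then show "\<forall>\<^sub>F N in sequentially. \<forall>s\<in>{s. Re s > \<sigma>}. dist (euler_factors N s * dirichlet_L chi s) 1 < e"
    using eventually_gt_at_top[of 0]
  proof eventually_elim
    case (elim N)
    show ?case
    proof
      fix s assume "s \<in> {s. Re s > \<sigma>}"
      then have "norm (euler_factors N s * dirichlet_L chi s - 1) \<le> real N powr (1 - \<sigma>) / (\<sigma> - 1)"
        using elim by (intro euler_factors_mult_dirichlet_L[OF assms]) auto
      then show "dist (euler_factors N s * dirichlet_L chi s) 1 < e" using elim by (simp add: dist_norm)
    qed
  qed
qed

lemma euler_factors_mult_dirichlet_L_tendsto: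
  assumes "Re s > 1"
  shows "(\<lambda>N. euler_factors N s * dirichlet_L chi s) \<longlonglongrightarrow> 1"
proof -
  define \<sigma> where "\<sigma> = (1 + Re s) / 2"
  have "\<sigma> > 1" "Re s > \<sigma>" using assms by (auto simp: \<sigma>_def)
  then show ?thesis
    using tendsto_uniform_limitI[OF euler_factors_mult_dirichlet_L_uniform, of \<sigma> s] by simp
qed

lemma dirichlet_L_nonzero:
  assumes "Re s > 1"
  shows "dirichlet_L chi s \<noteq> 0"
proof
  assume "dirichlet_L chi s = 0"
  then have "(\<lambda>N::nat. 0::complex) \<longlonglongrightarrow> 1"
    using euler_factors_mult_dirichlet_L_tendsto[OF assms] by simp
  then show False by (simp add: LIMSEQ_const_iff)
qed

lemma euler_factor_nonzero:
  assumes "prime p" "Re s > 0"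
  shows "1 - chi p * of_nat p powr (-s) \<noteq> 0"
proof
  assume "1 - chi p * of_nat p powr (-s) = 0"
  then have "norm (chi p * of_nat p powr (-s)) = 1" by simp
  then show False
    using norm_chi_powr_le[of p s] prime_powr_less_one[OF assms] by simp
qed

lemma euler_factors_holomorphic: "euler_factors N holomorphic_on A"
proof -
  have "(\<lambda>s. 1 - chi p * of_nat p powr (-s)) holomorphic_on A" if "prime p" for p
    using prime_gt_0_nat[OF that] unfolding powr_def by (auto intro!: holomorphic_intros)
  then show ?thesis unfolding euler_factors_def by (intro holomorphic_on_prod) auto
qed

lemma norm_euler_factor_logderiv_le:
  assumes p: "prime p" and s: "Re s > 0"
  shows "norm (chi p * of_nat p powr (-s) * of_real (ln (real p)) / (1 - chi p * of_nat p powr (-s)))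
     \<le> ln (real p) / (real p powr Re s - 1)"
proof -
  define x where "x = chi p * of_nat p powr (-s)"
  define r where "r = real p powr (- Re s)"
  have x: "norm x \<le> r" unfolding x_def r_def by (rule norm_chi_powr_le)
  have r: "0 < r" "r < 1" using prime_powr_less_one[OF assms] by (auto simp: r_def)
  have l: "ln (real p) > 0" using prime_gt_1_nat[OF p] by simp
  have "1 - r \<le> norm (1 - x)" using x norm_triangle_ineq2[of 1 x] by simp
  then have "norm x * ln (real p) / norm (1 - x) \<le> r * ln (real p) / (1 - r)"
    using x r l by (intro frac_le mult_right_mono) auto
  also have "\<dots> = ln (real p) / (real p powr Re s - 1)"
    using prime_gt_1_nat[OF p] r by (simp add: r_def powr_minus_divide field_simps)
  finally show ?thesis using l by (simp add: x_def norm_mult norm_divide)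
qed

text \<open>The products \<open>W N\<close> tend to 1 and their derivatives to 0, so the logarithmic
  derivative \<open>T N\<close> + L'/L tends to 0. Each term of \<open>T N\<close> is dominated by
  the corresponding term of -\<zeta>'/\<zeta>, whose partial sums are already bounded.\<close>

lemma norm_dirichlet_L_logderiv_le:
  assumes "Re s > 1"
  shows "norm (deriv (dirichlet_L chi) s / dirichlet_L chi s) \<le> 2 * ln 2 / (Re s - 1) + 1"
proof -
  define \<sigma> where "\<sigma> = (1 + Re s) / 2"
  have \<sigma>: "\<sigma> > 1" "Re s > \<sigma>" using assms by (auto simp: \<sigma>_def)
  let ?A = "{s. Re s > \<sigma>}"
  define W where "W = (\<lambda>N s. euler_factors N s * dirichlet_L chi s)"
  define L where "L = dirichlet_L chi"
  define T where "T = (\<lambda>N. \<Sum>p | prime p \<and> p \<le> N.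
      chi p * of_nat p powr (-s) * of_real (ln (real p)) / (1 - chi p * of_nat p powr (-s)))"
  have holL: "L holomorphic_on ?A"
    unfolding L_def using \<sigma> by (intro holomorphic_on_subset[OF dirichlet_L_holomorphic]) auto
  have openA: "open ?A" by (rule open_halfspace_Re_gt)
  have sA: "s \<in> ?A" using \<sigma> by simp
  have L0: "L s \<noteq> 0" unfolding L_def by (rule dirichlet_L_nonzero[OF assms])
  have "(\<lambda>N. deriv (W N) s) \<longlonglongrightarrow> deriv (\<lambda>_. 1) s"
  proof (rule deriv_complex_uniform_limit[OF _ _ _ openA sA])
    show "uniform_limit ?A W (\<lambda>_. 1) sequentially"
      unfolding W_def by (rule euler_factors_mult_dirichlet_L_uniform[OF \<sigma>(1)])
    show "\<forall>\<^sub>F N in sequentially. W N holomorphic_on ?A"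
      unfolding W_def by (intro always_eventually allI holomorphic_intros euler_factors_holomorphic holL[unfolded L_def])
  qed auto
  then have dW: "(\<lambda>N. deriv (W N) s) \<longlonglongrightarrow> 0" by simp
  have WN: "deriv (W N) s = W N s * (T N + deriv L s / L s)" for N
  proof -
    have "((\<lambda>u. \<Prod>p | prime p \<and> p \<le> N. 1 - chi p * of_nat p powr (-u)) has_field_derivative
        (\<Prod>p | prime p \<and> p \<le> N. 1 - chi p * of_nat p powr (-s)) *
        (\<Sum>p | prime p \<and> p \<le> N. (chi p * of_nat p powr (-s) * of_real (ln (real p))) / (1 - chi p * of_nat p powr (-s)))) (at s)"
    proof (rule has_field_derivative_prod')
      fix p assume "p \<in> {p. prime p \<and> p \<le> N}"
      then have p: "prime p" "p > 0" by (auto simp: prime_gt_0_nat)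
      then show "1 - chi p * of_nat p powr (-s) \<noteq> 0" using assms by (intro euler_factor_nonzero) auto
      show "((\<lambda>u. 1 - chi p * of_nat p powr (-u)) has_field_derivative chi p * of_nat p powr (-s) * of_real (ln (real p))) (at s)"
      proof -
        have "((\<lambda>u. of_nat p powr (-u)) has_field_derivative (Ln (of_nat p) * of_nat p powr (-s)) * (-1)) (at s)"
          by (rule DERIV_chain2[OF has_field_derivative_powr_right])
             (use p in \<open>auto intro!: derivative_eq_intros\<close>)
        from DERIV_diff[OF DERIV_const DERIV_cmult[OF this], of 1 "chi p"]
        show ?thesis using p by (simp add: Ln_of_nat mult_ac)
      qed
    qed
    then have Q: "(euler_factors N has_field_derivative euler_factors N s * T N) (at s)"
      by (simp add: euler_factors_def[abs_def] T_def)
    have dL: "(L has_field_derivative deriv L s) (at s)"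
      by (rule holomorphic_derivI[OF holL openA sA])
    have "(W N has_field_derivative euler_factors N s * T N * L s + deriv L s * euler_factors N s) (at s)"
      unfolding W_def L_def[symmetric] by (rule DERIV_mult[OF Q dL])
    then have "deriv (W N) s = euler_factors N s * T N * L s + deriv L s * euler_factors N s"
      by (rule DERIV_imp_deriv)
    also have "\<dots> = W N s * (T N + deriv L s / L s)"
      using L0 by (simp add: W_def L_def[symmetric] field_simps)
    finally show ?thesis .
  qed
  have W1: "(\<lambda>N. W N s) \<longlonglongrightarrow> 1"
    unfolding W_def by (rule euler_factors_mult_dirichlet_L_tendsto[OF assms])
  have "(\<lambda>N. deriv (W N) s / W N s) \<longlonglongrightarrow> 0"
    using tendsto_divide[OF dW W1] by simp
  moreover have "\<forall>\<^sub>F N in sequentially. deriv (W N) s / W N s = T N + deriv L s / L s"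
    using tendsto_imp_eventually_ne[OF W1, of 0] by (auto elim!: eventually_mono simp: WN)
  ultimately have "(\<lambda>N. T N + deriv L s / L s) \<longlonglongrightarrow> 0"
    by (rule Lim_transform_eventually)
  from tendsto_diff[OF this tendsto_const, of "deriv L s / L s"]
  have "T \<longlonglongrightarrow> - (deriv L s / L s)" by simp
  moreover have "norm (T N) \<le> 2 * ln 2 / (Re s - 1) + 1" for N
  proof -
    have "norm (T N) \<le> (\<Sum>p | prime p \<and> p \<le> N. ln (real p) / (real p powr Re s - 1))"
      unfolding T_def by (rule sum_norm_le, rule norm_euler_factor_logderiv_le) (use assms in auto)
    also have "\<dots> \<le> 2 * ln 2 / (Re s - 1) + 1" by (rule sum_prime_logderiv_le[OF assms])
    finally show ?thesis .
  qed
  ultimately have "norm (- (deriv L s / L s)) \<le> 2 * ln 2 / (Re s - 1) + 1"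
    by (intro Lim_norm_ubound[of sequentially T]) auto
  then show ?thesis by (simp add: L_def)
qed

text \<open>Each reciprocal factor has norm at most exp (p powr (- Re s)), so by
  \<open>sum_prime_powr_le\<close> their products stay below Re s / (Re s - 1); times L they tend to
  1. Used at 9/8, the bound provides the normalisation of \<open>g\<close>.\<close>

lemma norm_dirichlet_L_ge:
  assumes "Re s > 1"
  shows "norm (dirichlet_L chi s) \<ge> (Re s - 1) / Re s"
proof -
  have "norm (euler_factors N s) \<le> Re s / (Re s - 1)" for N
  proof -
    have "norm (euler_factors N s) \<le> (\<Prod>p | prime p \<and> p \<le> N. exp (real p powr (- Re s)))"
      unfolding euler_factors_def prod_norm[symmetric]
    proof (rule prod_mono, safe)
      fix p :: nat
      have "norm (1 - chi p * of_nat p powr (-s)) \<le> 1 + real p powr (- Re s)"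
        using norm_triangle_ineq4[of 1 "chi p * of_nat p powr (-s)"] norm_chi_powr_le[of p s] by simp
      also have "\<dots> \<le> exp (real p powr (- Re s))" by (rule exp_ge_add_one_self)
      finally show "norm (1 - chi p * of_nat p powr (-s)) \<le> exp (real p powr (- Re s))" .
    qed auto
    also have "\<dots> = exp (\<Sum>p | prime p \<and> p \<le> N. real p powr (- Re s))" by (simp add: exp_sum)
    also have "\<dots> \<le> exp (ln (1 + 1 / (Re s - 1)))" using sum_prime_powr_le[OF assms] by simp
    also have "\<dots> = Re s / (Re s - 1)" using assms by (subst exp_ln) (auto simp: field_simps add_pos_pos)
    finally show ?thesis .
  qed
  then have "norm (euler_factors N s * dirichlet_L chi s) \<le> Re s / (Re s - 1) * norm (dirichlet_L chi s)" for N
    unfolding norm_mult by (intro mult_right_mono) auto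
  then have "norm (1::complex) \<le> Re s / (Re s - 1) * norm (dirichlet_L chi s)"
    by (intro Lim_norm_ubound[OF _ euler_factors_mult_dirichlet_L_tendsto[OF assms]]) auto
  then show ?thesis using assms by (simp add: field_simps)
qed

section \<open>Comparison of L just to the right of 1 with the prime sum\<close>

lemma ln_norm_euler_factor_approx:
  assumes p: "prime p" and \<sigma>: "\<sigma> > 1"
  shows "\<bar>ln (norm (1 - chi p * of_nat p powr (- of_real \<sigma>))) + Re (chi p) * real p powr (-\<sigma>)\<bar> \<le> 2 * real p powr (-2)"
proof -
  define x where "x = chi p * of_nat p powr (- of_real \<sigma>)"
  have p2: "real p \<ge> 2" using prime_ge_2_nat[OF p] by simp
  have "of_nat p powr (- of_real \<sigma>) = (of_real (real p powr (-\<sigma>)) :: complex)"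
    using powr_of_real[of "real p" "-\<sigma>"] by simp
  then have Rex: "Re x = Re (chi p) * real p powr (-\<sigma>)" by (simp add: x_def)
  \<comment> \<open>The exponent is weakened from \<sigma> to 1 so that the resulting error p^-2 is
    independent of \<sigma> and sums to O(1) however close \<sigma> is to 1.\<close>
  have le: "norm x \<le> real p powr (-1)"
  proof -
    have "norm x \<le> real p powr (-\<sigma>)" using norm_chi_powr_le[of p "of_real \<sigma>"] by (simp add: x_def)
    also have "\<dots> \<le> real p powr (-1)" using p2 \<sigma> by (intro powr_mono) auto
    finally show ?thesis .
  qed
  have half: "real p powr (-1) \<le> 1 / 2" using p2 by (simp add: powr_minus_divide field_simps)
  have nx: "norm x \<le> 1 / 2" using le half by linarith
  have ne: "1 - x \<noteq> 0"
  proof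
    assume "1 - x = 0"
    then have "x = 1" by simp
    then show False using nx by simp
  qed
  have "norm (Ln (1 - x) + x) \<le> (norm x)\<^sup>2 / (1 - norm x)"
    using Ln_approx_linear[of "-x"] nx by simp
  also have "\<dots> \<le> (norm x)\<^sup>2 / (1 / 2)"
    using nx by (intro divide_left_mono) auto
  also have "\<dots> \<le> 2 * (real p powr (-1))\<^sup>2"
    using power_mono[OF le, of 2] by simp
  also have "(real p powr (-1))\<^sup>2 = real p powr (-2)"
    using p2 by (simp add: powr_minus_divide power_divide)
  finally have "norm (Ln (1 - x) + x) \<le> 2 * real p powr (-2)" .
  moreover have "\<bar>Re (Ln (1 - x) + x)\<bar> \<le> norm (Ln (1 - x) + x)" by (rule abs_Re_le_cmod)
  moreover have "Re (Ln (1 - x) + x) = ln (norm (1 - x)) + Re (chi p) * real p powr (-\<sigma>)"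
    using ne Rex by simp
  ultimately show ?thesis unfolding x_def by linarith
qed

lemma ln_norm_euler_factors_approx:
  assumes \<sigma>: "\<sigma> > 1"
  shows "\<bar>ln (norm (euler_factors N (of_real \<sigma>))) + (\<Sum>p | prime p \<and> p \<le> N. Re (chi p) * real p powr (-\<sigma>))\<bar> \<le> 2"
proof -
  have "ln (norm (euler_factors N (of_real \<sigma>))) = (\<Sum>p | prime p \<and> p \<le> N. ln (norm (1 - chi p * of_nat p powr (- of_real \<sigma>))))"
    unfolding euler_factors_def prod_norm[symmetric]
    using euler_factor_nonzero[of _ "of_real \<sigma>"] \<sigma> by (intro ln_prod) auto
  then have "\<bar>ln (norm (euler_factors N (of_real \<sigma>))) + (\<Sum>p | prime p \<and> p \<le> N. Re (chi p) * real p powr (-\<sigma>))\<bar>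
     = \<bar>\<Sum>p | prime p \<and> p \<le> N. ln (norm (1 - chi p * of_nat p powr (- of_real \<sigma>))) + Re (chi p) * real p powr (-\<sigma>)\<bar>"
    by (simp add: sum.distrib)
  also have "\<dots> \<le> (\<Sum>p | prime p \<and> p \<le> N. 2 * real p powr (-2))"
    by (rule sum_abs[THEN order.trans], rule sum_mono) (use ln_norm_euler_factor_approx \<sigma> in auto)
  also have "\<dots> = 2 * (\<Sum>p | prime p \<and> p \<le> N. real p powr (-2))" by (simp add: sum_distrib_left)
  also have "\<dots> \<le> 2 * ln 2" using sum_prime_powr_le[of 2 N] by simp
  also have "\<dots> \<le> 2" using ln_2_less_1 by simp
  finally show ?thesis .
qed

text \<open>For p \<le> y changing the exponent from 1 + \<delta> to 1 costs O(1), and the primes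
  beyond y form a tail. With \<delta> of the order of 1/ln y, as in the application, both errors are
  bounded.\<close>

lemma prime_sum_shift_approx:
  fixes y \<delta> :: real
  assumes y: "y > 1" and \<delta>: "0 < \<delta>" "\<delta> \<le> 1" "\<delta> * ln y \<le> 1" and N: "y \<le> real N"
  shows "\<bar>(\<Sum>p | prime p \<and> p \<le> N. Re (chi p) * real p powr (-(1 + \<delta>)))
          - (\<Sum>p | prime p \<and> real p \<le> y. Re (chi p) / real p)\<bar> \<le> 3 * exp 1 + (2 / \<delta> + 1) / ln y"
proof -
  define A where "A = {p. prime p \<and> real p \<le> y}"
  define B where "B = {p. prime p \<and> y < real p \<and> p \<le> N}"
  have AB: "{p. prime p \<and> p \<le> N} = A \<union> B" "A \<inter> B = {}"
    using N by (auto simp: A_def B_def)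
  have fin: "finite A" "finite B"
  proof -
    have "finite {p. prime p \<and> p \<le> N}" by simp
    then have "finite (A \<union> B)" unfolding AB(1) .
    then show "finite A" "finite B" by auto
  qed
  have ReC: "\<bar>Re (chi p)\<bar> \<le> 1" for p using abs_Re_le_cmod[of "chi p"] norm_chi_le[of p] by linarith
  have "(\<Sum>p | prime p \<and> p \<le> N. Re (chi p) * real p powr (-(1 + \<delta>)))
          - (\<Sum>p | prime p \<and> real p \<le> y. Re (chi p) / real p)
      = (\<Sum>p\<in>B. Re (chi p) * real p powr (-(1 + \<delta>))) - (\<Sum>p\<in>A. Re (chi p) * (1 / real p - real p powr (-(1 + \<delta>))))"
    unfolding AB(1) A_def[symmetric] using fin AB(2)
    by (simp add: sum.union_disjoint right_diff_distrib sum_subtractf)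
  moreover have "\<bar>\<Sum>p\<in>B. Re (chi p) * real p powr (-(1 + \<delta>))\<bar> \<le> (\<Sum>p\<in>B. real p powr (-(1 + \<delta>)))"
    by (rule sum_abs[THEN order.trans], rule sum_mono) (use ReC in \<open>auto simp: abs_mult mult_left_le_one_le\<close>)
  moreover have "(\<Sum>p\<in>B. real p powr (-(1 + \<delta>))) \<le> (2 / \<delta> + 1) / ln y"
    unfolding B_def by (rule sum_prime_powr_tail_le[OF y \<delta>(1)])
  moreover have "\<bar>\<Sum>p\<in>A. Re (chi p) * (1 / real p - real p powr (-(1 + \<delta>)))\<bar> \<le> (\<Sum>p\<in>A. 1 / real p - real p powr (-(1 + \<delta>)))"
  proof (rule sum_abs[THEN order.trans], rule sum_mono)
    fix p assume "p \<in> A"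
    then have p: "real p > 1" using prime_gt_1_nat[of p] by (auto simp: A_def)
    have "real p powr (-(1 + \<delta>)) \<le> real p powr (-1)" using p \<delta> by (intro powr_mono) auto
    then have "1 / real p - real p powr (-(1 + \<delta>)) \<ge> 0" using p by (simp add: powr_minus_divide)
    then show "\<bar>Re (chi p) * (1 / real p - real p powr (-(1 + \<delta>)))\<bar> \<le> 1 / real p - real p powr (-(1 + \<delta>))"
      unfolding abs_mult using ReC[of p] by (simp add: mult_left_le_one_le)
  qed
  moreover have "(\<Sum>p\<in>A. 1 / real p - real p powr (-(1 + \<delta>))) \<le> 3 * exp 1"
    unfolding A_def using y \<delta> by (intro sum_prime_reciprocal_diff_le) auto
  ultimately show ?thesis by linarith
qed

lemma norm_dirichlet_L_approx:
  fixes y \<delta> :: real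
  assumes y: "y > 1" and \<delta>: "0 < \<delta>" "\<delta> \<le> 1" "\<delta> * ln y \<le> 1"
  defines "C \<equiv> 2 + 3 * exp 1 + (2 / \<delta> + 1) / ln y"
  defines "T \<equiv> exp (\<Sum>p | prime p \<and> real p \<le> y. Re (chi p) / real p)"
  shows "exp (-C) * T \<le> norm (dirichlet_L chi (of_real (1 + \<delta>)))"
    and "norm (dirichlet_L chi (of_real (1 + \<delta>))) \<le> exp C * T"
proof -
  define s where "s = (of_real (1 + \<delta>) :: complex)"
  define q where "q = (\<lambda>N. norm (euler_factors N s))"
  have s1: "Re s > 1" using \<delta> by (simp add: s_def)
  have lim: "(\<lambda>N. q N * norm (dirichlet_L chi s)) \<longlonglongrightarrow> 1"
    using tendsto_norm[OF euler_factors_mult_dirichlet_L_tendsto[OF s1]] by (simp add: q_def norm_mult)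
  have q: "exp (-C) / T \<le> q N \<and> q N \<le> exp C / T" if N: "N \<ge> nat \<lceil>y\<rceil>" for N
  proof -
    have yN: "y \<le> real N" using N by linarith
    have "euler_factors N s \<noteq> 0"
      unfolding euler_factors_def using euler_factor_nonzero[of _ s] s1 by auto
    then have q0: "q N > 0" by (simp add: q_def)
    have "\<bar>ln (q N) + (\<Sum>p | prime p \<and> real p \<le> y. Re (chi p) / real p)\<bar> \<le> C"
      using ln_norm_euler_factors_approx[of "1 + \<delta>" N] prime_sum_shift_approx[OF y \<delta> yN] \<delta>
      unfolding q_def s_def C_def by linarith
    then have "\<bar>ln (q N) + ln T\<bar> \<le> C" by (simp add: T_def)
    then have "- C - ln T \<le> ln (q N)" "ln (q N) \<le> C - ln T" by auto
    then have "exp (- C - ln T) \<le> exp (ln (q N))" "exp (ln (q N)) \<le> exp (C - ln T)" by auto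
    moreover have "T > 0" by (simp add: T_def)
    ultimately show ?thesis using q0 by (simp add: exp_diff)
  qed
  have T: "T > 0" by (simp add: T_def)
  have "1 \<le> exp C / T * norm (dirichlet_L chi s)"
    by (rule LIMSEQ_le_const2[OF lim], intro exI[of _ "nat \<lceil>y\<rceil>"] allI impI mult_right_mono)
       (use q in auto)
  then show "exp (-C) * T \<le> norm (dirichlet_L chi (of_real (1 + \<delta>)))"
    using T by (simp add: s_def exp_minus field_simps)
  have "exp (-C) / T * norm (dirichlet_L chi s) \<le> 1"
    by (rule LIMSEQ_le_const[OF lim], intro exI[of _ "nat \<lceil>y\<rceil>"] allI impI mult_right_mono)
       (use q in auto)
  then show "norm (dirichlet_L chi (of_real (1 + \<delta>))) \<le> exp C * T"
    using T by (simp add: s_def exp_minus field_simps)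
qed

text \<open>The upper half of Mertens' estimate for the sum of 1/p, with 1/\<delta> in the role of
  ln y. It converts the bounds involving the prime sum into those involving only log log D.\<close>

lemma exp_abs_prime_sum_le:
  fixes y \<delta> :: real
  assumes y: "y \<ge> 1" and \<delta>: "0 < \<delta>" "\<delta> \<le> 1" "\<delta> * ln y \<le> 1"
  shows "exp \<bar>\<Sum>p | prime p \<and> real p \<le> y. Re (chi p) / real p\<bar> \<le> exp (3 * exp 1) * (1 + 1 / \<delta>)"
proof -
  have eq: "{p. prime p \<and> real p \<le> y} = {p. prime p \<and> p \<le> nat \<lfloor>y\<rfloor>}"
    using y by (auto simp: le_nat_floor le_floor_iff nat_le_iff le_nat_iff)
  have ReC: "\<bar>Re (chi p)\<bar> \<le> 1" for p using abs_Re_le_cmod[of "chi p"] norm_chi_le[of p] by linarith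
  have "\<bar>\<Sum>p | prime p \<and> real p \<le> y. Re (chi p) / real p\<bar> \<le> (\<Sum>p | prime p \<and> real p \<le> y. 1 / real p)"
    by (rule sum_abs[THEN order.trans], rule sum_mono) (use ReC in \<open>auto intro!: divide_right_mono\<close>)
  also have "\<dots> = (\<Sum>p | prime p \<and> real p \<le> y. 1 / real p - real p powr (-(1 + \<delta>)))
                + (\<Sum>p | prime p \<and> p \<le> nat \<lfloor>y\<rfloor>. real p powr (-(1 + \<delta>)))"
    unfolding eq by (simp add: sum_subtractf)
  also have "\<dots> \<le> 3 * exp 1 + ln (1 + 1 / (1 + \<delta> - 1))"
    using y \<delta> by (intro add_mono sum_prime_reciprocal_diff_le sum_prime_powr_le) auto
  finally have "exp \<bar>\<Sum>p | prime p \<and> real p \<le> y. Re (chi p) / real p\<bar> \<le> exp (3 * exp 1 + ln (1 + 1 / \<delta>))"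
    by simp
  also have "\<dots> = exp (3 * exp 1) * (1 + 1 / \<delta>)" using \<delta> by (simp add: exp_add add_pos_pos)
  finally show ?thesis .
qed

end

section \<open>Removing the exceptional zero\<close>

text \<open>976 = 16 + 960 adds the coefficients of the two terms of \<open>damped_logderiv\<close>
  on the outer disc, 8 times 2 from m and 768 times 5/8 times 2 from g'/g; exp 48 is the price of
  \<open>push_bound_left\<close>.\<close>

definition logderiv_const :: real where "logderiv_const = 976 * exp 48"

text \<open>771 = 768 + 3 serves both the outer bound with coefficient 768 and the inner bound with
  3 + \<open>logderiv_const\<close>.\<close>

definition smooth_const :: real where "smooth_const = (771 + logderiv_const) * exp 48"

lemma logderiv_const_ge_1: "logderiv_const \<ge> 1"
  using exp_ge_add_one_self[of 48] by (simp add: logderiv_const_def)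

lemma smooth_const_pos: "smooth_const > 0"
  using logderiv_const_ge_1 by (simp add: smooth_const_def)

text \<open>Here \<open>m\<close> is the multiplicity of \<beta>, and \<open>n\<close> is both the
  exponent in the three circles argument and the reciprocal of the distance to 1. The condition n
  \<ge> 17 makes 1/n smaller than 1/16, so that the inner radius 1/8 - 1/n stays above 1/16 and the
  target radius 1/8 + 2/n below 1/4.\<close>

locale exceptional_zero = nonprincipal_character +
  fixes \<beta> :: real and m n :: nat and g :: "complex \<Rightarrow> complex"
  assumes D_ge: "D \<ge> 7" and \<beta>: "3/4 < \<beta>" "\<beta> \<le> 1" and m_pos: "m > 0"
    and g_holo: "g holomorphic_on {s. Re s > 0}" and g_nonzero: "\<And>s. Re s > 3/4 \<Longrightarrow> g s \<noteq> 0"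
    and factor: "\<And>s. Re s > 0 \<Longrightarrow> dirichlet_L chi s = (s - of_real \<beta>) ^ m * g s"
    and n_ge: "n \<ge> 17" and lnD_le: "ln (real D) \<le> exp (real n / 16)"
begin

text \<open>Around 9/8, radius 1 remains in Re s > 0, radius 3/8 touches the line Re s = 3/4, radius
  1/4 reaches Re s = 7/8, and radius 1/8 touches Re s = 1.\<close>

abbreviation "c0 \<equiv> (of_real (9/8) :: complex)"
abbreviation "E \<equiv> (\<lambda>s. deriv g s / g s)"

definition \<delta> :: real where "\<delta> = 1 / real n"

lemma \<delta>_pos: "0 < \<delta>" and \<delta>_le: "\<delta> \<le> 1/17" and n_\<delta>: "real n * \<delta> = 1"
  using n_ge by (auto simp: \<delta>_def field_simps)

lemma Re_ge_of_cball: "s \<in> cball c0 r \<Longrightarrow> Re s \<ge> 9/8 - r"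
  using abs_Re_le_cmod[of "c0 - s"] by (simp add: dist_norm)

lemma Re_gt_of_ball: "s \<in> ball c0 r \<Longrightarrow> Re s > 9/8 - r"
  using abs_Re_le_cmod[of "c0 - s"] by (simp add: dist_norm)

lemma norm_c0_minus_beta: "norm (c0 - of_real \<beta>) = 9/8 - \<beta>"
proof -
  have "norm (c0 - of_real \<beta>) = \<bar>9/8 - \<beta>\<bar>" by (simp only: norm_of_real flip: of_real_diff)
  then show ?thesis using \<beta> by simp
qed

section \<open>Bounds of order log D for the multiplicity and for g'/g\<close>

lemma lnD_ge_1: "ln (real D) \<ge> 1"
proof -
  have "exp 1 \<le> (3::real)" by (rule exp_le)
  then have "exp 1 \<le> real D" using D_ge by linarith
  then show ?thesis using D_ge by (simp add: ln_ge_iff)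
qed

text \<open>On the boundary circle the distance to \<beta> is at least 1 - 3/8, so there the bound
  for L can be divided by the power; the maximum principle carries the result to the interior,
  across \<beta> itself.\<close>

lemma norm_g_le:
  assumes "s \<in> cball c0 1"
  shows "norm (g s) \<le> 27 * real D * (8/5) ^ m"
proof (rule maximum_modulus_frontier[of g "cball c0 1"])
  have sub: "cball c0 1 \<subseteq> {s. Re s > 0}" using Re_ge_of_cball[of _ 1] by force
  show "g holomorphic_on interior (cball c0 1)"
    using sub by (intro holomorphic_on_subset[OF g_holo]) (use interior_subset in blast)
  show "continuous_on (closure (cball c0 1)) g"
    using sub by (intro holomorphic_on_imp_continuous_on holomorphic_on_subset[OF g_holo]) simp
  fix z assume "z \<in> frontier (cball c0 1)"
  then have z: "norm (z - c0) = 1" by (simp add: dist_norm norm_minus_commute)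
  then have zc: "z \<in> cball c0 1" by (simp add: dist_norm norm_minus_commute)
  have Rez: "Re z \<ge> 1/8" using Re_ge_of_cball[OF zc] by simp
  have "norm z \<le> norm (z - c0) + norm c0" by (metis diff_add_cancel norm_triangle_ineq)
  then have nz: "norm z \<le> 3" using z by simp
  have "norm (dirichlet_L chi z) \<le> real D * norm z * (1 + 1 / Re z)"
    using Rez by (intro norm_dirichlet_L_le) auto
  also have "\<dots> \<le> real D * 3 * 9"
    using Rez nz by (intro mult_mono) (auto simp: field_simps)
  finally have L: "norm (dirichlet_L chi z) \<le> 27 * real D" by simp
  have "norm (z - c0) \<le> norm (z - of_real \<beta>) + norm (c0 - of_real \<beta>)"
    using norm_triangle_ineq4[of "z - of_real \<beta>" "c0 - of_real \<beta>"] by simp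
  then have d: "norm (z - of_real \<beta>) \<ge> 5/8" using z norm_c0_minus_beta \<beta> by linarith
  have "(5/8) ^ m * norm (g z) \<le> norm (z - of_real \<beta>) ^ m * norm (g z)"
    using d by (intro mult_right_mono power_mono) auto
  also have "\<dots> = norm (dirichlet_L chi z)"
    using factor[of z] Rez by (simp add: norm_mult norm_power)
  finally have "(5/8) ^ m * norm (g z) \<le> 27 * real D" using L by linarith
  then show "norm (g z) \<le> 27 * real D * (8/5) ^ m"
    by (simp add: power_divide field_simps)
qed (use assms in auto)

lemma norm_g_c0_ge: "norm (g c0) \<ge> 1/9 * (8/3) ^ m"
proof -
  have "1/9 \<le> norm (dirichlet_L chi c0)"
    using norm_dirichlet_L_ge[of c0] by simp
  also have "\<dots> = (9/8 - \<beta>) ^ m * norm (g c0)"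
    using factor[of c0] norm_c0_minus_beta by (simp add: norm_mult norm_power)
  also have "\<dots> \<le> (3/8) ^ m * norm (g c0)"
    using \<beta> by (intro mult_right_mono power_mono) auto
  finally show ?thesis by (simp add: power_divide field_simps)
qed

text \<open>The boundary bound grows like (8/5)^m, the value at the centre like (8/3)^m. The
  surviving factor (3/5)^m is a gain in the manner of Jensen's formula and limits \<open>m\<close>.
  The constant 243 = 27 * 9 is at most 7^3, hence at most D^3.\<close>

lemma norm_g_ratio_le:
  assumes "s \<in> cball c0 1"
  shows "norm (g s) \<le> exp (4 * ln (real D)) * (3/5) ^ m * norm (g c0)"
proof -
  have "243 * real D \<le> real D ^ 3 * real D"
    using power_mono[of 7 "real D" 3] D_ge by (intro mult_right_mono) auto
  also have "\<dots> = exp (4 * ln (real D))"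
    using D_ge exp_of_nat_mult[of 4 "ln (real D)"] by (simp add: power_Suc2[symmetric] del: power_Suc)
  finally have D3: "243 * real D \<le> exp (4 * ln (real D))" .
  have "norm (g s) \<le> 27 * real D * (8/5) ^ m" by (rule norm_g_le[OF assms])
  also have "(8/5 :: real) ^ m = (3/5) ^ m * (8/3) ^ m" by (simp flip: power_mult_distrib)
  also have "27 * real D * ((3/5) ^ m * (8/3) ^ m) = 243 * real D * (3/5) ^ m * (1/9 * (8/3) ^ m)" by simp
  also have "\<dots> \<le> exp (4 * ln (real D)) * (3/5) ^ m * norm (g c0)"
    using D3 norm_g_c0_ge by (intro mult_mono) auto
  finally show ?thesis .
qed

text \<open>At the centre itself the ratio is 1, so D^4 (3/5)^m cannot be smaller than 1; finally
  e^(1/2) \<le> 5/3.\<close>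

lemma m_le: "real m \<le> 8 * ln (real D)"
proof -
  have "norm (g c0) * 1 \<le> norm (g c0) * (exp (4 * ln (real D)) * (3/5) ^ m)"
    using norm_g_ratio_le[of c0] by (simp add: mult_ac)
  moreover have "norm (g c0) > 0" using g_nonzero[of c0] by simp
  ultimately have "1 \<le> exp (4 * ln (real D)) * (3/5) ^ m" by (simp only: mult_le_cancel_left_pos)
  then have "(5/3) ^ m \<le> exp (4 * ln (real D))" by (simp add: power_divide field_simps)
  moreover have "exp (real m / 2) \<le> (5/3 :: real) ^ m"
  proof -
    have "exp (1/2 :: real) \<le> 5/3"
      by (rule power2_le_imp_le) (use e_less_272 in \<open>auto simp: power2_eq_square simp flip: exp_add\<close>)
    then have "exp (1/2 :: real) ^ m \<le> (5/3) ^ m" by (intro power_mono) auto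
    then show ?thesis by (simp flip: exp_of_nat_mult)
  qed
  ultimately have "exp (real m / 2) \<le> exp (4 * ln (real D))" by linarith
  then show ?thesis by simp
qed

lemma norm_E_le:
  assumes "s \<in> cball c0 (1/4)"
  shows "norm (E s) \<le> 768 * ln (real D)"
proof -
  have "norm (E s) \<le> 8 * (4 * ln (real D)) * (3/8) / (3/8 - 1/4)\<^sup>2"
  proof (rule norm_logderiv_le[where c = c0])
    show "g holomorphic_on ball c0 (3/8)"
      by (rule holomorphic_on_subset[OF g_holo]) (use Re_gt_of_ball[of _ "3/8"] in force)
    show "g z \<noteq> 0" if "z \<in> ball c0 (3/8)" for z
      using Re_gt_of_ball[OF that] by (intro g_nonzero) simp
    show "norm (g z) \<le> exp (4 * ln (real D)) * norm (g c0)" if "z \<in> ball c0 (3/8)" for z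
    proof -
      have "norm (g z) \<le> exp (4 * ln (real D)) * (3/5) ^ m * norm (g c0)"
        using that by (intro norm_g_ratio_le) auto
      also have "\<dots> \<le> exp (4 * ln (real D)) * 1 * norm (g c0)"
        by (intro mult_right_mono mult_left_mono power_le_one) auto
      finally show ?thesis by simp
    qed
  qed (use lnD_ge_1 assms in auto)
  then show ?thesis by (simp add: power2_eq_square)
qed

lemma E_holo: "E holomorphic_on {s. Re s > 3/4}"
proof -
  have "g holomorphic_on {s. Re s > 3/4}" by (rule holomorphic_on_subset[OF g_holo]) auto
  then show ?thesis
    using g_nonzero by (intro holomorphic_intros holomorphic_deriv open_halfspace_Re_gt) auto
qed

lemma logderiv_L:
  assumes "Re s > 3/4" "s \<noteq> of_real \<beta>"
  shows "dirichlet_L chi s \<noteq> 0"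
    and "deriv (dirichlet_L chi) s / dirichlet_L chi s = of_nat m / (s - of_real \<beta>) + E s"
proof -
  have s0: "s \<in> {s. Re s > 0}" using assms by simp
  show nz: "dirichlet_L chi s \<noteq> 0"
    using factor[of s] g_nonzero[of s] assms by simp
  have dg: "(g has_field_derivative deriv g s) (at s)"
    by (rule holomorphic_derivI[OF g_holo open_halfspace_Re_gt s0])
  have "((\<lambda>s. (s - of_real \<beta>) ^ m * g s) has_field_derivative
      of_nat m * (s - of_real \<beta>) ^ (m - 1) * g s + deriv g s * (s - of_real \<beta>) ^ m) (at s)"
    by (rule DERIV_mult[OF _ dg]) (auto intro!: derivative_eq_intros)
  then have "(dirichlet_L chi has_field_derivative
      of_nat m * (s - of_real \<beta>) ^ (m - 1) * g s + deriv g s * (s - of_real \<beta>) ^ m) (at s)"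
    by (rule has_field_derivative_transform_within_open[OF _ open_halfspace_Re_gt s0])
       (use factor in auto)
  then have "deriv (dirichlet_L chi) s =
      of_nat m * (s - of_real \<beta>) ^ (m - 1) * g s + deriv g s * (s - of_real \<beta>) ^ m"
    by (rule DERIV_imp_deriv)
  moreover have "dirichlet_L chi s = (s - of_real \<beta>) * (s - of_real \<beta>) ^ (m - 1) * g s"
    using factor[of s] assms m_pos by (cases m) auto
  moreover have "(s - of_real \<beta>) ^ m = (s - of_real \<beta>) * (s - of_real \<beta>) ^ (m - 1)"
    using m_pos by (cases m) auto
  moreover have "(M * P * G + G' * (w * P)) / (w * P * G) = M / w + G' / G"
    if "w \<noteq> 0" "P \<noteq> 0" "G \<noteq> 0" for w P G M G' :: complex
    using that by (simp add: field_simps)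
  ultimately show "deriv (dirichlet_L chi) s / dirichlet_L chi s = of_nat m / (s - of_real \<beta>) + E s"
    using assms g_nonzero[of s] by simp
qed

section \<open>Carrying bounds across the line Re s = 1\<close>

lemma norm_logderiv_L_le:
  assumes "Re s \<ge> 1 + \<delta>"
  shows "norm (deriv (dirichlet_L chi) s / dirichlet_L chi s) \<le> 3 * real n"
proof -
  note d = \<delta>_pos
  have "norm (deriv (dirichlet_L chi) s / dirichlet_L chi s) \<le> 2 * ln 2 / (Re s - 1) + 1"
    using assms d by (intro norm_dirichlet_L_logderiv_le) linarith
  also have "2 * ln 2 / (Re s - 1) \<le> 2 * 1 / \<delta>"
    using assms d ln_2_less_1 by (intro frac_le) auto
  also have "2 * 1 / \<delta> + 1 \<le> 3 * real n" using n_ge by (simp add: \<delta>_def)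
  finally show ?thesis by simp
qed

text \<open>The inner disc lies in \<open>Re s \<ge> 1 + 1/n\<close>, where Dirichlet series bounds are available.
  The maximum principle pushes such a bound past the line \<open>Re s = 1\<close> at the cost of a constant
  factor only, because the radius increases by a factor \<open>1 + O(1/n)\<close> while the bound on the
  outer circle is only exponential in \<open>n\<close>.\<close>

lemma push_bound_left:
  assumes holo: "F holomorphic_on {s. Re s > 3/4}" and A: "A \<ge> 0"
    and inner: "\<And>s. s \<in> cball c0 (1/8 - \<delta>) \<Longrightarrow> norm (F s) \<le> A"
    and outer: "\<And>s. s \<in> cball c0 (1/4) \<Longrightarrow> norm (F s) \<le> A * 2 ^ n"
    and s: "s \<in> cball c0 (1/8 + 2 * \<delta>)"
  shows "norm (F s) \<le> A * exp 48"
proof -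
  have n: "real n \<ge> 17" using n_ge by simp
  note d = \<delta>_pos \<delta>_le
  define r where "r = 1/8 - \<delta>"
  have r: "1/16 < r" "r < 1/8" using d by (auto simp: r_def)
  show ?thesis
  proof (cases "dist c0 s \<le> r")
    case True
    then have "norm (F s) \<le> A * 1" using inner[of s] by (simp add: r_def)
    also have "\<dots> \<le> A * exp 48" using A by (intro mult_left_mono) auto
    finally show ?thesis .
  next
    case False
    have holo': "F holomorphic_on cball c0 (1/4)"
      by (rule holomorphic_on_subset[OF holo]) (use Re_ge_of_cball[of _ "1/4"] in force)
    have "norm (F s) \<le> A * (dist c0 s / r) ^ n"
    proof (rule norm_le_three_circles_power[where R = "1/4"])
      show "F holomorphic_on ball c0 (1/4)"
        by (rule holomorphic_on_subset[OF holo']) auto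
      show "continuous_on (cball c0 (1/4)) F"
        by (rule holomorphic_on_imp_continuous_on[OF holo'])
      show "norm (F z) \<le> A * (1/4 / r) ^ n" if "z \<in> sphere c0 (1/4)" for z
      proof -
        have "norm (F z) \<le> A * 2 ^ n" using that by (intro outer) auto
        \<comment> \<open>Since r < 1/8, the outer radius is more than twice the inner one, which is
          why growth by 2^n is allowed on the outer disc.\<close>
        also have "\<dots> \<le> A * (1/4 / r) ^ n"
          using A r by (intro mult_left_mono power_mono) (auto simp: field_simps)
        finally show ?thesis .
      qed
    qed (use False r s d inner in \<open>auto simp: r_def\<close>)
    \<comment> \<open>48 = 3 * 16: the target radius exceeds \<open>r\<close> by 3\<delta>, and r >
      1/16 makes this a relative excess of at most 48\<delta>. The n-th power is at most exp 48
      because n\<delta> = 1.\<close>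
    also have "\<dots> \<le> A * (1 + 48 * \<delta>) ^ n"
    proof -
      have "dist c0 s \<le> r + 3 * \<delta>" using s by (simp add: r_def)
      also have "3 * \<delta> \<le> r * (48 * \<delta>)" using r d by (simp add: mult.commute)
      finally have "dist c0 s \<le> (1 + 48 * \<delta>) * r" by (simp add: algebra_simps)
      then show ?thesis using A r by (intro mult_left_mono power_mono) (auto simp: pos_divide_le_eq)
    qed
    also have "\<dots> \<le> A * exp 48"
    proof -
      have "(1 + 48 * \<delta>) ^ n \<le> exp (48 * \<delta>) ^ n" using d by (intro power_mono exp_ge_add_one_self) auto
      also have "\<dots> = exp 48" using n_\<delta> by (simp flip: exp_of_nat_mult)
      finally show ?thesis using A by (intro mult_left_mono) auto
    qed
    finally show ?thesis .
  qed
qed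

section \<open>The logarithmic derivative with its pole at \<beta> cancelled\<close>

lemma exp_n_le: "exp (real n / 16) \<le> (8/5) ^ n"
proof -
  have "exp (1/16 :: real) \<le> 1 + 1/16 + (1/16)\<^sup>2" by (rule exp_bound) auto
  then have "exp (1/16 :: real) \<le> 8/5" by (simp add: power2_eq_square)
  then have "exp (1/16 :: real) ^ n \<le> (8/5) ^ n" by (intro power_mono) auto
  then show ?thesis by (simp flip: exp_of_nat_mult)
qed

text \<open>The cancelling factor divided by s - \<beta>, written as a geometric sum so that it is a
  polynomial, with value 2n at \<beta>. The scaling by 2 makes the base of the powers at most 1 in
  norm on the disc of radius 1/2 about \<beta> + 1/2, which contains the inner disc for every
  admissible \<beta>.\<close>

definition damping :: "complex \<Rightarrow> complex" where
  "damping s = 2 * (\<Sum>j<n. (1 - 2 * (s - of_real \<beta>)) ^ j)"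

lemma mult_damping: "(s - of_real \<beta>) * damping s = 1 - (1 - 2 * (s - of_real \<beta>)) ^ n"
proof -
  define q where "q = 1 - 2 * (s - of_real \<beta>)"
  have "(s - of_real \<beta>) * damping s = (1 - q) * (\<Sum>j<n. q ^ j)" by (simp add: damping_def q_def)
  also have "\<dots> = 1 - q ^ n" by (rule one_diff_power_eq[symmetric])
  finally show ?thesis by (simp add: q_def)
qed

text \<open>L'/L times the cancelling factor, with the polar part m/(s - \<beta>) already multiplied
  out, so that the expression is holomorphic at \<beta> as well.\<close>

definition damped_logderiv :: "complex \<Rightarrow> complex" where
  "damped_logderiv s = of_nat m * damping s + E s * ((s - of_real \<beta>) * damping s)"

lemma damped_logderiv_eq:
  assumes "Re s > 3/4" "s \<noteq> of_real \<beta>"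
  shows "damped_logderiv s
    = deriv (dirichlet_L chi) s / dirichlet_L chi s * (1 - (1 - 2 * (s - of_real \<beta>)) ^ n)"
  unfolding logderiv_L(2)[OF assms] mult_damping[symmetric] damped_logderiv_def
  using assms by (simp add: field_simps)

lemma norm_q_le:
  assumes "s \<in> cball c0 r"
  shows "norm (1 - 2 * (s - of_real \<beta>)) \<le> 2 * r + 3/4"
proof -
  have "1 - 2 * (s - of_real \<beta>) = 2 * (c0 - s) + of_real (2 * \<beta> - 5/4)" by (simp add: algebra_simps)
  also have "norm \<dots> \<le> norm (2 * (c0 - s)) + norm (of_real (2 * \<beta> - 5/4) :: complex)"
    by (rule norm_triangle_ineq)
  also have "norm (of_real (2 * \<beta> - 5/4) :: complex) \<le> 3/4"
    using \<beta> by (simp only: norm_of_real)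
  also have "norm (2 * (c0 - s)) \<le> 2 * r" using assms by (simp only: norm_mult norm_numeral mem_cball dist_norm)
  finally show ?thesis by simp
qed

text \<open>On the inner disc the cancelling factor is at most 2 and L'/L at most 3n. On the outer
  disc \<open>m\<close> and g'/g are only O(log D), hence O((8/5)^n), and \<open>damping\<close> is
  at most 2n (5/4)^n; the product stays within a multiple of n 2^n.\<close>

lemma norm_damped_logderiv_le:
  assumes "s \<in> cball c0 (1/8 + 2 * \<delta>)"
  shows "norm (damped_logderiv s) \<le> logderiv_const * real n"
proof -
  have n: "real n \<ge> 17" using n_ge by simp
  note d = \<delta>_pos
  have "norm (damped_logderiv s) \<le> (976 * real n) * exp 48"
  proof (rule push_bound_left[OF _ _ _ _ assms])
    show "damped_logderiv holomorphic_on {s. Re s > 3/4}"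
      unfolding damped_logderiv_def damping_def by (intro holomorphic_intros E_holo)
  next
    fix z assume z: "z \<in> cball c0 (1/8 - \<delta>)"
    have Rez: "Re z \<ge> 1 + \<delta>" using Re_ge_of_cball[OF z] by simp
    have "Re z > \<beta>" using Rez \<beta> d by linarith
    then have ne: "z \<noteq> of_real \<beta>" by auto
    have z34: "Re z > 3/4" using Rez d by linarith
    have "norm (1 - 2 * (z - of_real \<beta>)) \<le> 1" using norm_q_le[OF z] d by simp
    then have "norm ((1 - 2 * (z - of_real \<beta>)) ^ n) \<le> 1" by (simp add: norm_power power_le_one)
    then have "norm (1 - (1 - 2 * (z - of_real \<beta>)) ^ n) \<le> 2"
      using norm_triangle_ineq4[of 1 "(1 - 2 * (z - of_real \<beta>)) ^ n"] by simp
    then have "norm (damped_logderiv z) \<le> (3 * real n) * 2"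
      unfolding damped_logderiv_eq[OF z34 ne] norm_mult
      by (intro mult_mono norm_logderiv_L_le Rez) auto
    then show "norm (damped_logderiv z) \<le> 976 * real n" by simp
  next
    fix z assume z: "z \<in> cball c0 (1/4)"
    define q where "q = 1 - 2 * (z - of_real \<beta>)"
    have q: "norm q \<le> 5/4" using norm_q_le[OF z] by (simp add: q_def)
    have "norm (damping z) = 2 * norm (\<Sum>j<n. q ^ j)"
      by (simp add: damping_def q_def norm_mult)
    also have "norm (\<Sum>j<n. q ^ j) \<le> (\<Sum>j<n. (5/4) ^ n)"
    proof (rule sum_norm_le)
      fix j assume "j \<in> {..<n}"
      have "norm (q ^ j) \<le> (5/4) ^ j" unfolding norm_power using q by (intro power_mono) auto
      also have "\<dots> \<le> (5/4) ^ n" using \<open>j \<in> {..<n}\<close> by (intro power_increasing) auto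
      finally show "norm (q ^ j) \<le> (5/4) ^ n" .
    qed
    finally have damp: "norm (damping z) \<le> 2 * real n * (5/4) ^ n" by simp
    have "norm (z - of_real \<beta>) \<le> norm (z - c0) + norm (c0 - of_real \<beta>)"
      using norm_triangle_ineq[of "z - c0" "c0 - of_real \<beta>"] by simp
    then have w: "norm (z - of_real \<beta>) \<le> 5/8"
      using z norm_c0_minus_beta \<beta> by (simp add: dist_norm norm_minus_commute)
    have "norm (damped_logderiv z) \<le> real m * norm (damping z) + norm (E z) * (norm (z - of_real \<beta>) * norm (damping z))"
      unfolding damped_logderiv_def by (rule norm_triangle_ineq[THEN order.trans]) (simp only: norm_mult norm_of_nat order.refl)
    also have "\<dots> \<le> (8 * ln (real D)) * (2 * real n * (5/4) ^ n)
        + (768 * ln (real D)) * (5/8 * (2 * real n * (5/4) ^ n))"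
      using m_le norm_E_le[OF z] damp w lnD_ge_1 by (intro add_mono mult_mono) auto
    also have "\<dots> = 976 * real n * (ln (real D) * (5/4) ^ n)" by (simp add: algebra_simps)
    also have "\<dots> \<le> 976 * real n * ((8/5) ^ n * (5/4) ^ n)"
      using lnD_le exp_n_le by (intro mult_left_mono mult_right_mono) auto
    also have "(8/5) ^ n * (5/4) ^ n = (2::real) ^ n" by (simp flip: power_mult_distrib)
    finally show "norm (damped_logderiv z) \<le> 976 * real n * 2 ^ n" .
  qed (use n in auto)
  then show ?thesis by (simp add: logderiv_const_def mult_ac)
qed

section \<open>From logarithmic derivatives to the values at 1 and 1 + 1/n\<close>

lemma real_mem_cball:
  assumes "1 - 2 * \<delta> \<le> x" "x \<le> 1 + \<delta>"
  shows "of_real x \<in> cball c0 (1/8 + 2 * \<delta>)"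
proof -
  have "\<bar>9/8 - x\<bar> \<le> 1/8 + 2 * \<delta>" using assms \<delta>_pos \<delta>_le by linarith
  moreover have "dist c0 (of_real x) = \<bar>9/8 - x\<bar>"
    by (simp only: dist_norm norm_of_real flip: of_real_diff)
  ultimately show ?thesis by simp
qed

lemma closed_segment_real_cases:
  assumes "z \<in> closed_segment (of_real 1) (of_real (1 + \<delta>))"
  obtains x where "z = of_real x" "1 \<le> x" "x \<le> 1 + \<delta>"
proof -
  obtain u where u: "0 \<le> u" "u \<le> 1" "z = (1 - u) *\<^sub>R of_real 1 + u *\<^sub>R of_real (1 + \<delta>)"
    using assms by (auto simp: closed_segment_def)
  have "u * \<delta> \<le> \<delta>" using u \<delta>_pos by (intro mult_left_le_one_le) auto
  moreover have "z = of_real (1 + u * \<delta>)"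
  proof -
    have "z = of_real ((1 - u) * 1 + u * (1 + \<delta>))"
      by (simp only: u(3) scaleR_conv_of_real of_real_add of_real_mult)
    then show ?thesis by (simp add: algebra_simps)
  qed
  ultimately show ?thesis using that[of "1 + u * \<delta>"] u \<delta>_pos by simp
qed

text \<open>Integration of a logarithmic derivative of size K n over an interval of length 1/n
  changes log |h| by at most K.\<close>

lemma compare_via_logderiv:
  assumes holo: "h holomorphic_on {s. Re s > a}" and nz: "\<And>s. Re s > a \<Longrightarrow> h s \<noteq> 0" and a: "a < 1"
    and bound: "\<And>x. 1 \<le> x \<Longrightarrow> x \<le> 1 + \<delta> \<Longrightarrow> norm (deriv h (of_real x) / h (of_real x)) \<le> K * real n"
  shows "norm (h 1) \<le> exp K * norm (h (of_real (1 + \<delta>)))"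
    and "norm (h (of_real (1 + \<delta>))) \<le> exp K * norm (h 1)"
proof -
  have dist: "dist (of_real 1) (of_real (1 + \<delta>) :: complex) = \<delta>"
    by (simp only: dist_norm norm_of_real flip: of_real_diff) (use \<delta>_pos in simp)
  let ?S = "{s. Re s > a}"
  have S: "open ?S" "convex ?S" by (auto simp: open_halfspace_Re_gt convex_halfspace_Re_gt)
  have sub: "closed_segment (of_real 1) (of_real (1 + \<delta>)) \<subseteq> ?S"
  proof
    fix z assume "z \<in> closed_segment (of_real 1 :: complex) (of_real (1 + \<delta>))"
    then show "z \<in> ?S" by (rule closed_segment_real_cases) (use a in auto)
  qed
  have b: "norm (deriv h z / h z) \<le> K * real n" if "z \<in> closed_segment (of_real 1) (of_real (1 + \<delta>))" for z
    using that by (rule closed_segment_real_cases) (use bound in auto)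
  have "norm (h (of_real 1)) \<le> exp ((K * real n) * dist (of_real 1) (of_real (1 + \<delta>) :: complex)) * norm (h (of_real (1 + \<delta>)))"
    by (rule norm_le_exp_logderiv_bound[OF holo S _ sub b]) (use nz in auto)
  then show "norm (h 1) \<le> exp K * norm (h (of_real (1 + \<delta>)))"
    unfolding dist using n_\<delta> by (simp add: mult.assoc)
  have "norm (h (of_real (1 + \<delta>))) \<le> exp ((K * real n) * dist (of_real (1 + \<delta>)) (of_real 1 :: complex)) * norm (h (of_real 1))"
    by (rule norm_le_exp_logderiv_bound[OF holo S _ sub[unfolded closed_segment_commute[of "of_real 1"]]
          b[unfolded closed_segment_commute[of "of_real 1"]]]) (use nz in auto)
  then show "norm (h (of_real (1 + \<delta>))) \<le> exp K * norm (h 1)"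
    unfolding dist_commute[of "of_real (1 + \<delta>)"] dist using n_\<delta> by (simp add: mult.assoc)
qed

lemma L1_compare_far:
  assumes far: "1 - \<beta> \<ge> \<delta>"
  shows "norm (dirichlet_L chi 1) \<le> exp (2 * logderiv_const) * norm (dirichlet_L chi (of_real (1 + \<delta>)))"
    and "norm (dirichlet_L chi (of_real (1 + \<delta>))) \<le> exp (2 * logderiv_const) * norm (dirichlet_L chi 1)"
proof -
  have n: "real n \<ge> 17" using n_ge by simp
  note d = \<delta>_pos \<delta>_le
  have holo: "dirichlet_L chi holomorphic_on {s. Re s > \<beta>}"
    by (rule holomorphic_on_subset[OF dirichlet_L_holomorphic]) (use \<beta> in auto)
  have nz: "dirichlet_L chi s \<noteq> 0" if "Re s > \<beta>" for s
    by (rule logderiv_L(1)) (use that \<beta> in auto)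
  have "norm (deriv (dirichlet_L chi) (of_real x) / dirichlet_L chi (of_real x)) \<le> 2 * logderiv_const * real n"
    if x: "1 \<le> x" "x \<le> 1 + \<delta>" for x
  proof -
    define q where "q = 1 - 2 * (x - \<beta>)"
    define l where "l = deriv (dirichlet_L chi) (of_real x) / dirichlet_L chi (of_real x)"
    \<comment> \<open>From x - \<beta> \<ge> \<delta> follows q^n \<le> exp (-2), so the cancelling
      factor 1 - q^n is at least 1/2 and division by it is harmless. Nonnegativity of q holds
      because x - \<beta> < 1/4 + 1/17.\<close>
    have q: "0 \<le> q" "q \<le> 1 - 2 * \<delta>" using x far \<beta> d by (auto simp: q_def)
    have "q ^ n \<le> exp (- (2 * \<delta>)) ^ n"
      using q exp_ge_add_one_self[of "- (2 * \<delta>)"] by (intro power_mono) auto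
    also have "\<dots> = exp (-2)" using n_\<delta> by (simp flip: exp_of_nat_mult)
    also have "\<dots> \<le> 1/2"
      using exp_ge_add_one_self[of 2] by (simp add: exp_minus field_simps)
    finally have q2: "1 - q ^ n \<ge> 1/2" by simp
    have "damped_logderiv (of_real x) = l * (1 - (1 - 2 * (of_real x - of_real \<beta>)) ^ n)"
      unfolding l_def using x far d \<beta> by (intro damped_logderiv_eq) auto
    also have "1 - (1 - 2 * (of_real x - of_real \<beta>)) ^ n = (of_real (1 - q ^ n) :: complex)"
      by (simp add: q_def)
    finally have "norm (damped_logderiv (of_real x)) = norm l * (1 - q ^ n)"
      using q2 by (simp only: norm_mult norm_of_real)
    also have "\<dots> \<ge> norm l * (1/2)" using q2 by (intro mult_left_mono) auto
    finally have "norm l * (1/2) \<le> logderiv_const * real n"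
      using norm_damped_logderiv_le[OF real_mem_cball[of x]] x d by linarith
    then show ?thesis by (simp add: l_def)
  qed
  from compare_via_logderiv[OF holo nz _ this]
  show "norm (dirichlet_L chi 1) \<le> exp (2 * logderiv_const) * norm (dirichlet_L chi (of_real (1 + \<delta>)))"
    and "norm (dirichlet_L chi (of_real (1 + \<delta>))) \<le> exp (2 * logderiv_const) * norm (dirichlet_L chi 1)"
    using far d by auto
qed

lemma m_le_logderiv_const:
  assumes near: "1 - \<beta> \<le> \<delta>"
  shows "real m \<le> logderiv_const"
proof -
  have n: "real n > 0" "\<delta> > 0" using n_ge \<delta>_pos by auto
  \<comment> \<open>At \<beta> all n summands of \<open>damping\<close> equal 1 and the term with
    g'/g vanishes.\<close>
  have "damped_logderiv (of_real \<beta>) = of_real (real m * (2 * real n))"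
    by (simp add: damped_logderiv_def damping_def)
  then have "norm (damped_logderiv (of_real \<beta>)) = real m * (2 * real n)"
    by (simp only: norm_of_real) simp
  then have "real m * (2 * real n) \<le> logderiv_const * real n"
    using norm_damped_logderiv_le[OF real_mem_cball[of \<beta>]] near \<beta> n by linarith
  then have "2 * real m * real n \<le> logderiv_const * real n" by simp
  then have "2 * real m \<le> logderiv_const" using n by (simp only: mult_le_cancel_right_pos)
  then show ?thesis by simp
qed

text \<open>With \<open>m\<close> bounded, the polar part can now be subtracted directly: on the
  inner disc the distance to \<beta> is at least 1/n, so m/(s - \<beta>) is O(n).\<close>

lemma norm_E_le_near:
  assumes near: "1 - \<beta> \<le> \<delta>" and s: "s \<in> cball c0 (1/8 + 2 * \<delta>)"
  shows "norm (E s) \<le> smooth_const * real n"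
proof -
  have n: "real n \<ge> 17" using n_ge by simp
  note d = \<delta>_pos
  have "norm (E s) \<le> ((771 + logderiv_const) * real n) * exp 48"
  proof (rule push_bound_left[OF E_holo _ _ _ s])
    fix z assume z: "z \<in> cball c0 (1/8 - \<delta>)"
    have Rez: "Re z \<ge> 1 + \<delta>" using Re_ge_of_cball[OF z] by simp
    have "Re z > \<beta>" using Rez \<beta> d by linarith
    then have ne: "z \<noteq> of_real \<beta>" by auto
    have z34: "Re z > 3/4" using Rez d by linarith
    have zb: "norm (z - of_real \<beta>) \<ge> \<delta>"
      using abs_Re_le_cmod[of "z - of_real \<beta>"] Rez \<beta> by simp
    have "E z = deriv (dirichlet_L chi) z / dirichlet_L chi z - of_nat m / (z - of_real \<beta>)"
      using logderiv_L(2)[OF z34 ne] by simp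
    then have "norm (E z) \<le> norm (deriv (dirichlet_L chi) z / dirichlet_L chi z) + norm (of_nat m / (z - of_real \<beta>))"
      by (metis norm_triangle_ineq4)
    also have "norm (of_nat m / (z - of_real \<beta>)) \<le> logderiv_const / \<delta>"
      unfolding norm_divide norm_of_nat using zb d m_le_logderiv_const[OF near] by (intro frac_le) auto
    also have "norm (deriv (dirichlet_L chi) z / dirichlet_L chi z) \<le> 3 * real n"
      by (rule norm_logderiv_L_le[OF Rez])
    finally have "norm (E z) \<le> (3 + logderiv_const) * real n" by (simp add: algebra_simps \<delta>_def)
    also have "\<dots> \<le> (771 + logderiv_const) * real n" by (intro mult_right_mono) auto
    finally show "norm (E z) \<le> (771 + logderiv_const) * real n" by simp
  next
    fix z assume z: "z \<in> cball c0 (1/4)"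
    have "norm (E z) \<le> 768 * ln (real D)" by (rule norm_E_le[OF z])
    also have "\<dots> \<le> 768 * (8/5) ^ n" using lnD_le exp_n_le by simp
    also have "\<dots> \<le> (771 + logderiv_const) * real n * 2 ^ n"
    proof (intro mult_mono power_mono)
      have "768 * 1 \<le> (771 + logderiv_const) * real n"
        using n logderiv_const_ge_1 by (intro mult_mono) auto
      then show "768 \<le> (771 + logderiv_const) * real n" by simp
    qed (use logderiv_const_ge_1 in auto)
    finally show "norm (E z) \<le> (771 + logderiv_const) * real n * 2 ^ n" .
  qed (use logderiv_const_ge_1 in auto)
  then show ?thesis by (simp add: smooth_const_def mult_ac)
qed

lemma g_compare_near:
  assumes near: "1 - \<beta> \<le> \<delta>"
  shows "norm (g 1) \<le> exp smooth_const * norm (g (of_real (1 + \<delta>)))"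
    and "norm (g (of_real (1 + \<delta>))) \<le> exp smooth_const * norm (g 1)"
proof -
  have holo: "g holomorphic_on {s. Re s > 3/4}" by (rule holomorphic_on_subset[OF g_holo]) auto
  note d = \<delta>_pos
  have "norm (deriv g (of_real x) / g (of_real x)) \<le> smooth_const * real n" if "1 \<le> x" "x \<le> 1 + \<delta>" for x
    using that d by (intro norm_E_le_near[OF near] real_mem_cball) auto
  from compare_via_logderiv[OF holo g_nonzero _ this]
  show "norm (g 1) \<le> exp smooth_const * norm (g (of_real (1 + \<delta>)))"
    and "norm (g (of_real (1 + \<delta>))) \<le> exp smooth_const * norm (g 1)" by auto
qed

text \<open>At x = 1 + 4(1 - \<beta>) the zero contributes m / (5(1 - \<beta>)) to L'/L, whereas
  comparison with \<zeta> allows 2 ln 2 / (4(1 - \<beta>)) + 1. Multiplied by 1 - \<beta>, this sets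
  m/5 against (ln 2)/2 < 0.35, which m \<ge> 2 violates unless the remaining terms, of size at most
  (1 + K)(1 - \<beta>) n, make up the difference.\<close>

lemma multiple_zero_not_too_near:
  assumes m: "m \<ge> 2" and \<beta>1: "\<beta> < 1"
  shows "(1 - \<beta>) * real n \<ge> 1 / (20 * (1 + smooth_const))"
proof (rule ccontr)
  define K where "K = smooth_const"
  have K: "K > 0" using smooth_const_pos by (simp add: K_def)
  assume "\<not> ?thesis"
  then have small: "(1 - \<beta>) * real n < 1 / (20 * (1 + K))" by (simp add: K_def)
  have n: "real n \<ge> 17" using n_ge by simp
  have "1 / (20 * (1 + K)) \<le> 1 / 20" using K by (intro divide_left_mono) auto
  then have small': "(1 - \<beta>) * real n < 1 / 20" using small by linarith
  then have near4: "4 * (1 - \<beta>) \<le> \<delta>" using n by (simp add: \<delta>_def field_simps)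
  moreover have "1 - \<beta> \<le> 4 * (1 - \<beta>)" using \<beta>1 by simp
  ultimately have near: "1 - \<beta> \<le> \<delta>" by (rule order.trans[rotated])
  note d = \<delta>_pos
  define x where "x = 1 + 4 * (1 - \<beta>)"
  have x: "1 < x" "x \<le> 1 + \<delta>" "x - \<beta> = 5 * (1 - \<beta>)" using \<beta>1 near4 by (auto simp: x_def)
  have "of_nat m / (of_real x - of_real \<beta>) = deriv (dirichlet_L chi) (of_real x) / dirichlet_L chi (of_real x) - E (of_real x)"
    using logderiv_L(2)[of "of_real x"] x \<beta> by simp
  then have le: "norm (of_nat m / (of_real x - of_real \<beta>) :: complex)
      \<le> norm (deriv (dirichlet_L chi) (of_real x) / dirichlet_L chi (of_real x)) + norm (E (of_real x))"
    by (metis norm_triangle_ineq4)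
  have le_L: "norm (deriv (dirichlet_L chi) (of_real x) / dirichlet_L chi (of_real x)) \<le> 2 * ln 2 / (x - 1) + 1"
    using norm_dirichlet_L_logderiv_le[of "of_real x"] x by simp
  have le_E: "norm (E (of_real x)) \<le> K * real n"
    unfolding K_def using x d by (intro norm_E_le_near[OF near] real_mem_cball) auto
  have "norm (of_nat m / (of_real x - of_real \<beta>) :: complex) = real m / (5 * (1 - \<beta>))"
  proof -
    have "of_nat m / (of_real x - of_real \<beta>) = (of_real (real m / (x - \<beta>)) :: complex)" by simp
    then show ?thesis using x(3) \<beta>1 by (simp only: norm_of_real) simp
  qed
  moreover have "x - 1 = 4 * (1 - \<beta>)" by (simp add: x_def)
  ultimately have "real m / (5 * (1 - \<beta>)) \<le> 2 * ln 2 / (4 * (1 - \<beta>)) + 1 + K * real n"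
    using le le_L le_E by (simp only:)
  moreover have "real m / 5 \<le> ln 2 / 2 + e + K * real n * e"
    if "real m / (5 * e) \<le> 2 * ln 2 / (4 * e) + 1 + K * real n" "e > 0" for e
  proof -
    have "real m / (5 * e) * e \<le> (2 * ln 2 / (4 * e) + 1 + K * real n) * e"
      using that by (intro mult_right_mono) auto
    then show ?thesis using that(2) by (simp add: distrib_right)
  qed
  moreover have "1 - \<beta> > 0" using \<beta>1 by simp
  ultimately have "real m / 5 \<le> ln 2 / 2 + (1 - \<beta>) + K * real n * (1 - \<beta>)" by blast
  moreover have "1 - \<beta> \<le> (1 - \<beta>) * real n" using \<beta>1 n by simp
  \<comment> \<open>2/5 - 25/72 = 19/360 is just above 1/20; this is the source of the 20 in the
    statement.\<close>
  moreover have "ln 2 \<le> (25/36 :: real)" by (rule ln2_le_25_over_36)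
  moreover have "real m \<ge> 2" using m by simp
  ultimately have "1 / 20 \<le> (1 + K) * ((1 - \<beta>) * real n)" by (simp add: algebra_simps)
  then show False using small K by (simp add: field_simps)
qed

end

section \<open>Comparison at the point 1\<close>

text \<open>The minimum covers the cases of \<beta> far from and near to 1. In the second, the power
  bounds t^m from below for a multiple zero: the exponent is an integer bound for \<open>m\<close>,
  and 40 is twice the 20 of \<open>multiple_zero_not_too_near\<close> because t \<ge> x/2.\<close>

definition lower_const :: real where
  "lower_const = min (exp (- 2 * logderiv_const))
     (exp (- smooth_const) * (1 / (40 * (1 + smooth_const))) ^ nat \<lceil>logderiv_const\<rceil>)"

definition upper_const :: real where
  "upper_const = exp (2 * logderiv_const) + exp smooth_const"

lemma lower_const_pos: "lower_const > 0"
  using smooth_const_pos by (simp add: lower_const_def)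

lemma upper_const_pos: "upper_const > 0"
  by (simp add: upper_const_def add_pos_pos)

context exceptional_zero
begin

text \<open>The quotient of |L(1)| by |L(1 + \<delta>)| is t^m times the quotient of the values of
  |g|, where t = (1 - \<beta>)/(1 + \<delta> - \<beta>) = x/(x + 1) lies between x/2 and x. Above,
  t^m \<le> t suffices. Below, a simple zero gives t \<ge> x/2 at once; for a multiple zero x is
  bounded away from 0, so t^m exceeds a constant, while x < 1.\<close>

lemma L1_compare_near:
  assumes \<beta>1: "\<beta> < 1" and near: "1 - \<beta> < \<delta>"
  defines "x \<equiv> (1 - \<beta>) * real n"
  shows "lower_const * x * norm (dirichlet_L chi (of_real (1 + \<delta>))) \<le> norm (dirichlet_L chi 1)"
    and "norm (dirichlet_L chi 1) \<le> upper_const * x * norm (dirichlet_L chi (of_real (1 + \<delta>)))"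
proof -
  define t where "t = x / (x + 1)"
  have n: "real n > 0" using n_ge by simp
  have x: "0 < x" "x < 1" using \<beta>1 near n by (auto simp: x_def \<delta>_def field_simps)
  have t: "x / 2 \<le> t" "t \<le> x" "0 < t" "t < 1" using x by (auto simp: t_def field_simps)
  define Lb where "Lb = norm (dirichlet_L chi (of_real (1 + \<delta>)))"
  have eq1: "1 - \<beta> = t * (1 + \<delta> - \<beta>)"
  proof -
    have "1 + \<delta> - \<beta> = (x + 1) / real n" using n by (simp add: x_def \<delta>_def field_simps)
    moreover have "1 - \<beta> = x / real n" using n by (simp add: x_def)
    moreover have "x / real n = t * ((x + 1) / real n)" using x by (simp add: t_def)
    ultimately show ?thesis by simp
  qed
  have L1: "norm (dirichlet_L chi 1) = (1 - \<beta>) ^ m * norm (g 1)"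
  proof -
    have "norm (1 - of_real \<beta> :: complex) = 1 - \<beta>"
      using \<beta>1 norm_of_real[of "1 - \<beta>", where ?'a = complex] by simp
    then show ?thesis using factor[of 1] by (simp add: norm_mult norm_power)
  qed
  have Lb: "Lb = (1 + \<delta> - \<beta>) ^ m * norm (g (of_real (1 + \<delta>)))"
  proof -
    have "norm (of_real (1 + \<delta>) - of_real \<beta> :: complex) = \<bar>1 + \<delta> - \<beta>\<bar>"
      by (simp only: norm_of_real flip: of_real_diff)
    then show ?thesis
      using factor[of "of_real (1 + \<delta>)"] \<delta>_pos \<beta>1 by (simp add: Lb_def norm_mult norm_power)
  qed
  have pos: "1 + \<delta> - \<beta> > 0" using \<beta>1 \<delta>_pos by linarith
  have near': "1 - \<beta> \<le> \<delta>" using near by simp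
  have L1': "norm (dirichlet_L chi 1) = t ^ m * ((1 + \<delta> - \<beta>) ^ m * norm (g 1))"
    unfolding L1 by (subst eq1) (simp add: power_mult_distrib)
  have Lb0: "Lb \<ge> 0" by (simp add: Lb_def)
  have "norm (dirichlet_L chi 1) \<le> t ^ m * ((1 + \<delta> - \<beta>) ^ m * (exp smooth_const * norm (g (of_real (1 + \<delta>)))))"
    unfolding L1' using g_compare_near(1)[OF near'] t pos by (intro mult_left_mono) auto
  also have "\<dots> = exp smooth_const * t ^ m * Lb" by (simp add: Lb)
  also have "\<dots> \<le> upper_const * x * Lb"
  proof (intro mult_right_mono mult_mono)
    have "t ^ m \<le> t ^ 1" using t m_pos by (intro power_decreasing) auto
    then show "t ^ m \<le> x" using t by simp
  qed (use t Lb0 in \<open>auto simp: upper_const_def add_pos_pos\<close>)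
  finally show "norm (dirichlet_L chi 1) \<le> upper_const * x * norm (dirichlet_L chi (of_real (1 + \<delta>)))"
    by (simp add: Lb_def)
  define a where "a = 1 / (40 * (1 + smooth_const))"
  have a: "0 < a" "a \<le> 1/2" using smooth_const_pos by (auto simp: a_def field_simps)
  have nc: "nat \<lceil>logderiv_const\<rceil> \<ge> 1" using logderiv_const_ge_1 by linarith
  have tm: "a ^ nat \<lceil>logderiv_const\<rceil> * x \<le> t ^ m"
  proof (cases "m = 1")
    case True
    have "a ^ nat \<lceil>logderiv_const\<rceil> \<le> a ^ 1" using a nc by (intro power_decreasing) auto
    then have "a ^ nat \<lceil>logderiv_const\<rceil> \<le> 1/2" using a by simp
    then have "a ^ nat \<lceil>logderiv_const\<rceil> * x \<le> (1/2) * x" using x by (intro mult_right_mono) auto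
    also have "\<dots> \<le> t" using t by simp
    finally show ?thesis using True by simp
  next
    case False
    then have "m \<ge> 2" using m_pos by simp
    then have "x \<ge> 1 / (20 * (1 + smooth_const))" unfolding x_def by (rule multiple_zero_not_too_near[OF _ \<beta>1])
    then have "1 / (20 * (1 + smooth_const)) / 2 \<le> x / 2" by (rule divide_right_mono) simp
    also have "\<dots> \<le> t" by (rule t(1))
    finally have "a \<le> t" by (simp add: a_def)
    have "a ^ nat \<lceil>logderiv_const\<rceil> * x \<le> a ^ nat \<lceil>logderiv_const\<rceil> * 1"
      using x a by (intro mult_left_mono) auto
    also have "\<dots> \<le> a ^ m"
    proof -
      have "m \<le> nat \<lceil>logderiv_const\<rceil>" using m_le_logderiv_const[OF near'] by linarith
      then show ?thesis using a power_decreasing[of m "nat \<lceil>logderiv_const\<rceil>" a] by simp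
    qed
    also have "\<dots> \<le> t ^ m" using \<open>a \<le> t\<close> a by (intro power_mono) auto
    finally show ?thesis .
  qed
  have "lower_const * x * Lb \<le> exp (- smooth_const) * a ^ nat \<lceil>logderiv_const\<rceil> * x * Lb"
    using x Lb0 by (intro mult_right_mono) (auto simp: lower_const_def a_def)
  also have "\<dots> = exp (- smooth_const) * (a ^ nat \<lceil>logderiv_const\<rceil> * x) * Lb" by simp
  also have "\<dots> \<le> exp (- smooth_const) * t ^ m * Lb"
    using tm Lb0 by (intro mult_right_mono mult_left_mono) auto
  also have "\<dots> \<le> exp (- smooth_const) * t ^ m * ((1 + \<delta> - \<beta>) ^ m * (exp smooth_const * norm (g 1)))"
    unfolding Lb using g_compare_near(2)[OF near'] pos t by (intro mult_left_mono) auto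
  also have "\<dots> = norm (dirichlet_L chi 1)"
    by (simp add: L1' exp_minus field_simps)
  finally show "lower_const * x * norm (dirichlet_L chi (of_real (1 + \<delta>))) \<le> norm (dirichlet_L chi 1)"
    by (simp add: Lb_def)
qed

lemma L1_compare:
  assumes \<beta>1: "\<beta> < 1"
  shows "lower_const * min 1 ((1 - \<beta>) * real n) * norm (dirichlet_L chi (of_real (1 + \<delta>))) \<le> norm (dirichlet_L chi 1)"
    and "norm (dirichlet_L chi 1) \<le> upper_const * min 1 ((1 - \<beta>) * real n) * norm (dirichlet_L chi (of_real (1 + \<delta>)))"
proof -
  have n: "real n > 0" using n_ge by simp
  have "lower_const * min 1 ((1 - \<beta>) * real n) * norm (dirichlet_L chi (of_real (1 + \<delta>))) \<le> norm (dirichlet_L chi 1)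
    \<and> norm (dirichlet_L chi 1) \<le> upper_const * min 1 ((1 - \<beta>) * real n) * norm (dirichlet_L chi (of_real (1 + \<delta>)))"
  proof (cases "1 - \<beta> < \<delta>")
    case True
    then have "(1 - \<beta>) * real n \<le> 1" using n by (simp add: \<delta>_def field_simps)
    then have "min 1 ((1 - \<beta>) * real n) = (1 - \<beta>) * real n" by simp
    then show ?thesis using L1_compare_near[OF \<beta>1 True] by simp
  next
    case False
    then have far: "1 - \<beta> \<ge> \<delta>" by simp
    then have "(1 - \<beta>) * real n \<ge> 1" using n by (simp add: \<delta>_def field_simps)
    then have m1: "min 1 ((1 - \<beta>) * real n) = 1" by simp
    let ?L = "norm (dirichlet_L chi (of_real (1 + \<delta>)))"
    have "lower_const * ?L \<le> exp (- 2 * logderiv_const) * ?L"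
      by (intro mult_right_mono) (auto simp: lower_const_def)
    also have "\<dots> \<le> exp (- 2 * logderiv_const) * (exp (2 * logderiv_const) * norm (dirichlet_L chi 1))"
      by (intro mult_left_mono L1_compare_far(2)[OF far]) auto
    also have "\<dots> = norm (dirichlet_L chi 1)" by (simp add: exp_minus field_simps)
    finally have "lower_const * ?L \<le> norm (dirichlet_L chi 1)" .
    moreover have "norm (dirichlet_L chi 1) \<le> upper_const * ?L"
      by (rule order.trans[OF L1_compare_far(1)[OF far]], intro mult_right_mono) (auto simp: upper_const_def)
    ultimately show ?thesis using m1 by simp
  qed
  then show "lower_const * min 1 ((1 - \<beta>) * real n) * norm (dirichlet_L chi (of_real (1 + \<delta>))) \<le> norm (dirichlet_L chi 1)"
    and "norm (dirichlet_L chi 1) \<le> upper_const * min 1 ((1 - \<beta>) * real n) * norm (dirichlet_L chi (of_real (1 + \<delta>)))"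
    by auto
qed

end

section \<open>Reality and sign of L(1) for real characters\<close>

context nonprincipal_character
begin

lemma dirichlet_L_real:
  assumes real: "\<And>n. chi n \<in> \<real>" and \<sigma>: "\<sigma> > 0"
  shows "dirichlet_L chi (of_real \<sigma>) \<in> \<real>"
proof -
  have "(\<lambda>n. chi (Suc n) * of_nat (Suc n) powr (- of_real \<sigma>)) sums dirichlet_L chi (of_real \<sigma>)"
    using dirichlet_L_sums[of "of_real \<sigma>"] dirichlet_L_eq_abel[of "of_real \<sigma>"] \<sigma> by simp
  moreover have "(\<Sum>n<N. chi (Suc n) * of_nat (Suc n) powr (- of_real \<sigma>)) \<in> \<real>" for N
  proof (intro sum_in_Reals Reals_mult real)
    fix n
    have "of_nat (Suc n) powr (- of_real \<sigma>) = (of_real (real (Suc n) powr (-\<sigma>)) :: complex)"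
      using powr_of_real[of "real (Suc n)" "-\<sigma>"] by simp
    then show "of_nat (Suc n) powr (- of_real \<sigma>) \<in> (\<real> :: complex set)" by (metis Reals_of_real)
  qed
  ultimately show ?thesis
    unfolding sums_def by (intro Lim_in_closed_set[OF closed_complex_Reals]) auto
qed

text \<open>For real \<open>chi\<close> the finite products of reciprocal Euler factors are
  nonnegative reals, and times L(\<sigma>) they tend to 1, which excludes a negative
  L(\<sigma>).\<close>

lemma dirichlet_L_nonneg:
  assumes real: "\<And>n. chi n \<in> \<real>" and \<sigma>: "\<sigma> > 1"
  shows "Re (dirichlet_L chi (of_real \<sigma>)) \<ge> 0"
proof (rule ccontr)
  assume neg: "\<not> ?thesis"
  have "Re (euler_factors N (of_real \<sigma>) * dirichlet_L chi (of_real \<sigma>)) \<le> 0" for N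
  proof -
    have eq: "euler_factors N (of_real \<sigma>) = of_real (\<Prod>p | prime p \<and> p \<le> N. 1 - Re (chi p) * real p powr (-\<sigma>))"
      unfolding euler_factors_def of_real_prod
    proof (rule prod.cong[OF refl])
      fix p
      have "of_nat p powr (- of_real \<sigma>) = (of_real (real p powr (-\<sigma>)) :: complex)"
        using powr_of_real[of "real p" "-\<sigma>"] by simp
      moreover have "chi p = of_real (Re (chi p))" using real[of p] by (simp add: of_real_Re)
      ultimately show "1 - chi p * of_nat p powr (- of_real \<sigma>) = of_real (1 - Re (chi p) * real p powr (-\<sigma>))"
        by (metis of_real_1 of_real_diff of_real_mult)
    qed
    have "(\<Prod>p | prime p \<and> p \<le> N. 1 - Re (chi p) * real p powr (-\<sigma>)) \<ge> 0"
    proof (rule prod_nonneg)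
      fix p assume "p \<in> {p. prime p \<and> p \<le> N}"
      then have "0 < real p powr (-\<sigma>)" "real p powr (-\<sigma>) < 1" using prime_powr_less_one[of p \<sigma>] \<sigma> by auto
      moreover have "Re (chi p) \<le> 1" using complex_Re_le_cmod[of "chi p"] norm_chi_le[of p] by linarith
      ultimately have "Re (chi p) * real p powr (-\<sigma>) \<le> 1 * 1" by (intro mult_mono) auto
      then show "0 \<le> 1 - Re (chi p) * real p powr (-\<sigma>)" by simp
    qed
    moreover have "Re (of_real q * dirichlet_L chi (of_real \<sigma>)) \<le> 0" if "q \<ge> 0" for q
      using that neg by (simp add: mult_nonneg_nonpos)
    ultimately show ?thesis unfolding eq by blast
  qed
  moreover have "(\<lambda>N. Re (euler_factors N (of_real \<sigma>) * dirichlet_L chi (of_real \<sigma>))) \<longlonglongrightarrow> Re 1"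
    using \<sigma> by (intro tendsto_Re euler_factors_mult_dirichlet_L_tendsto) simp
  ultimately have "Re 1 \<le> 0" by (intro LIMSEQ_le_const2) auto
  then show False by simp
qed

text \<open>The analytic estimates concern the modulus, the lower bounds of the theorem the real
  part. They coincide because L(1) is real and a limit of nonnegative values from the right.\<close>

lemma Re_dirichlet_L_1:
  assumes real: "\<And>n. chi n \<in> \<real>"
  shows "Re (dirichlet_L chi 1) = norm (dirichlet_L chi 1)"
proof -
  have "isCont (dirichlet_L chi) 1"
    using dirichlet_L_holomorphic
    by (intro continuous_on_interior[OF holomorphic_on_imp_continuous_on])
       (auto simp: interior_open open_halfspace_Re_gt)
  moreover have "(\<lambda>N. of_real (1 + 1 / real (Suc N)) :: complex) \<longlonglongrightarrow> of_real (1 + 0)"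
    by (intro tendsto_of_real tendsto_add tendsto_const LIMSEQ_Suc[OF lim_1_over_n])
  ultimately have "(\<lambda>N. Re (dirichlet_L chi (of_real (1 + 1 / real (Suc N))))) \<longlonglongrightarrow> Re (dirichlet_L chi 1)"
    by (intro tendsto_Re isCont_tendsto_compose[of 1 "dirichlet_L chi"]) auto
  moreover have "Re (dirichlet_L chi (of_real (1 + 1 / real (Suc N)))) \<ge> 0" for N
    by (rule dirichlet_L_nonneg[OF real]) simp
  ultimately have "Re (dirichlet_L chi 1) \<ge> 0" by (intro LIMSEQ_le_const) auto
  moreover have "dirichlet_L chi 1 \<in> \<real>" using dirichlet_L_real[OF real, of 1] by simp
  ultimately show ?thesis by (simp add: complex_is_Real_iff cmod_def)
qed

end

section \<open>Assembling the estimates for an exceptional zero\<close>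

lemma real_primitive_imp_nonprincipal:
  assumes "real_primitive_character D chi" "D > 1"
  shows "nonprincipal_character D chi"
proof
  show "dirichlet_character D chi" using assms by (simp add: real_primitive_character_def)
  show "\<exists>a. coprime a D \<and> chi a \<noteq> 1"
  proof (rule ccontr)
    assume "\<not> ?thesis"
    then have "induced_modulus D chi 1"
      unfolding induced_modulus_def dirichlet_character_def by (auto intro!: exI[of _ "\<lambda>_. 1"])
    then have "conductor D chi \<le> 1" unfolding conductor_def by (rule Least_le)
    then show False using assms by (simp add: real_primitive_character_def)
  qed
qed

lemma exceptional_zero_le_1:
  assumes "unique_exceptional_zero D chi \<beta>" "nonprincipal_character D chi"
  shows "\<beta> \<le> 1"
  using nonprincipal_character.dirichlet_L_nonzero[OF assms(2), of "of_real \<beta>"] assms(1)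
  by (force simp: unique_exceptional_zero_def)

lemma modulus_ge_7:
  assumes "ln (ln (real D)) > 1"
  shows "D \<ge> 7"
proof -
  \<comment> \<open>As \<open>ln 0 = 0\<close> in HOL, the values 0 and 1 of \<open>D\<close> both
    give ln D = 0 and then ln (ln D) = 0, against the assumption.\<close>
  have pos: "ln (real D) > 0"
  proof (rule ccontr)
    assume "\<not> ?thesis"
    moreover have "ln (real D) \<ge> 0" by (cases "D = 0") auto
    ultimately have "ln (real D) = 0" by simp
    then show False using assms by simp
  qed
  then have D0: "real D > 0" by (cases "D = 0") auto
  have "exp 1 \<ge> (5/2 :: real)" using exp_lower_Taylor_quadratic[of 1] by simp
  moreover have "exp 1 < exp (ln (ln (real D)))" using assms by simp
  ultimately have "ln (real D) > 5/2" using pos by simp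
  then have "exp (5/2) < exp (ln (real D))" by simp
  then have "real D > exp (5/2)" using D0 by simp
  moreover have "exp (5/2 :: real) \<ge> 6" using exp_lower_Taylor_quadratic[of "5/2"] by (simp add: power2_eq_square)
  ultimately show ?thesis by linarith
qed

text \<open>37 = 2 + 35: the summand (2n + 1) / log log D in the comparison with the prime sum is at
  most 35, because n \<le> 17 log log D and log log D > 1.\<close>

definition euler_const :: real where "euler_const = 37 + 3 * exp 1"

lemma exceptional_zero_estimates:
  assumes "unique_exceptional_zero D chi \<beta>"
  defines "T \<equiv> exp (prime_char_sum D chi)"
  shows "lower_const * exp (- euler_const) * (siegel_omega D \<beta> * T) \<le> norm (dirichlet_L chi 1)"
    and "norm (dirichlet_L chi 1) \<le> 17 * upper_const * exp euler_const * (siegel_omega D \<beta> * T)"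
    and "Re (dirichlet_L chi 1) = norm (dirichlet_L chi 1)"
    and "0 \<le> 1 - \<beta>"
    and "exp \<bar>prime_char_sum D chi\<bar> \<le> 18 * exp (3 * exp 1) * ln (ln (real D))"
proof -
  define \<l> where "\<l> = ln (ln (real D))"
  \<comment> \<open>Because log log D > 1, the factor 16 forces n \<ge> 17, and rounding up still
    leaves n \<le> 17 log log D. Also exp (n/16) \<ge> log D, as the locale demands.\<close>
  define n where "n = nat \<lceil>16 * \<l>\<rceil>"
  have prim: "real_primitive_character D chi" and l1: "\<l> > 1" and \<beta>34: "\<beta> > 3/4"
    and zero: "dirichlet_L chi (of_real \<beta>) = 0"
    and uniq: "\<And>s. Re s > 3/4 \<Longrightarrow> dirichlet_L chi s = 0 \<Longrightarrow> s = of_real \<beta>"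
    using assms(1) by (auto simp: unique_exceptional_zero_def \<l>_def)
  have D7: "D \<ge> 7" using l1 by (intro modulus_ge_7) (simp add: \<l>_def)
  interpret nonprincipal_character D chi
    using real_primitive_imp_nonprincipal[OF prim] D7 by simp
  have real: "chi k \<in> \<real>" for k using prim by (simp add: real_primitive_character_def)
  show re: "Re (dirichlet_L chi 1) = norm (dirichlet_L chi 1)" by (rule Re_dirichlet_L_1[OF real])
  have \<beta>1: "\<beta> \<le> 1" by (rule exceptional_zero_le_1[OF assms(1) nonprincipal_character_axioms])
  then show "0 \<le> 1 - \<beta>" by simp
  have n: "16 * \<l> \<le> real n" "real n \<le> 17 * \<l>" "n \<ge> 17"
    using l1 unfolding n_def by linarith+
  define y where "y = ln (real D)"
  have y: "y = exp \<l>" using D7 by (simp add: y_def \<l>_def)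
  have y1: "y > 1" using l1 by (simp add: y)
  have lny: "ln y = \<l>" by (simp add: y)
  define d where "d = 1 / real n"
  have d: "0 < d" "d \<le> 1" "d * ln y \<le> 1" using n l1 by (auto simp: d_def lny field_simps)
  have S: "prime_char_sum D chi = (\<Sum>p | prime p \<and> real p \<le> y. Re (chi p) / real p)"
    by (simp add: prime_char_sum_def y_def)
  have "exp \<bar>prime_char_sum D chi\<bar> \<le> exp (3 * exp 1) * (1 + 1 / d)"
    unfolding S using y1 d by (intro exp_abs_prime_sum_le) auto
  also have "\<dots> \<le> exp (3 * exp 1) * (18 * \<l>)"
    using n l1 by (intro mult_left_mono) (auto simp: d_def)
  finally show "exp \<bar>prime_char_sum D chi\<bar> \<le> 18 * exp (3 * exp 1) * ln (ln (real D))"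
    by (simp add: \<l>_def mult_ac)
  define Lb where "Lb = norm (dirichlet_L chi (of_real (1 + d)))"
  define C where "C = 2 + 3 * exp 1 + (2 / d + 1) / ln y"
  have "(2 / d + 1) / ln y \<le> 35"
    using n l1 by (simp add: d_def lny field_simps)
  then have C: "C \<le> euler_const" by (simp add: C_def euler_const_def)
  have T0: "T > 0" by (simp add: T_def)
  have Lb1: "exp (- euler_const) * T \<le> Lb"
  proof -
    have "exp (- euler_const) * T \<le> exp (-C) * T" using C T0 by (intro mult_right_mono) auto
    also have "\<dots> \<le> Lb" unfolding C_def T_def S Lb_def by (rule norm_dirichlet_L_approx(1)[OF y1 d])
    finally show ?thesis .
  qed
  have Lb2: "Lb \<le> exp euler_const * T"
  proof -
    have "Lb \<le> exp C * T" unfolding C_def T_def S Lb_def by (rule norm_dirichlet_L_approx(2)[OF y1 d])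
    also have "\<dots> \<le> exp euler_const * T" using C T0 by (intro mult_right_mono) auto
    finally show ?thesis .
  qed
  have Lb0: "Lb \<ge> 0" by (simp add: Lb_def)
  define \<omega> where "\<omega> = siegel_omega D \<beta>"
  define \<omega>' where "\<omega>' = min 1 ((1 - \<beta>) * real n)"
  have \<omega>: "\<omega> = min 1 ((1 - \<beta>) * \<l>)" by (simp add: \<omega>_def siegel_omega_def \<l>_def)
  have \<omega>0: "0 \<le> \<omega>" using \<beta>1 l1 by (simp add: \<omega>)
  have \<omega>1: "\<omega> \<le> \<omega>'"
  proof -
    have "(1 - \<beta>) * \<l> \<le> (1 - \<beta>) * real n" using \<beta>1 n l1 by (intro mult_left_mono) auto
    then show ?thesis by (simp add: \<omega> \<omega>'_def min_le_iff_disj)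
  qed
  \<comment> \<open>Replacing log log D by \<open>n\<close> in the minimum costs at most the factor
    17.\<close>
  have \<omega>2: "\<omega>' \<le> 17 * \<omega>"
  proof -
    have "(1 - \<beta>) * real n \<le> (1 - \<beta>) * (17 * \<l>)" using \<beta>1 n by (intro mult_left_mono) auto
    then show ?thesis by (auto simp: \<omega> \<omega>'_def min_def)
  qed
  have "lower_const * \<omega>' * Lb \<le> norm (dirichlet_L chi 1) \<and> norm (dirichlet_L chi 1) \<le> upper_const * \<omega>' * Lb"
  \<comment> \<open>For \<beta> = 1 all three quantities vanish: \<omega>' is 0 and L(1) is the
    assumed zero.\<close>
  proof (cases "\<beta> = 1")
    case True
    then show ?thesis using zero by (simp add: \<omega>'_def)
  next
    case False
    then have \<beta>lt: "\<beta> < 1" using \<beta>1 by simp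
    have conn: "connected {s. 0 < Re s}" by (intro convex_connected convex_halfspace_Re_gt)
    have nc: "\<not> dirichlet_L chi constant_on {s. 0 < Re s}"
    proof
      assume "dirichlet_L chi constant_on {s. 0 < Re s}"
      then obtain c where "\<And>s. Re s > 0 \<Longrightarrow> dirichlet_L chi s = c" by (auto simp: constant_on_def)
      then have "dirichlet_L chi 2 = dirichlet_L chi (of_real \<beta>)" using \<beta>34 by simp
      then show False using zero dirichlet_L_nonzero[of 2] by simp
    qed
    obtain m g where mg: "m > 0" "g holomorphic_on {s. 0 < Re s}" "g (of_real \<beta>) \<noteq> 0"
        "\<And>w. w \<in> {s. 0 < Re s} \<Longrightarrow> dirichlet_L chi w = (w - of_real \<beta>) ^ m * g w"
      using holomorphic_factor_zero_global[OF dirichlet_L_holomorphic open_halfspace_Re_gt conn _ zero nc] \<beta>34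
      by auto
    have g0: "g s \<noteq> 0" if s: "Re s > 3/4" for s
    proof (cases "s = of_real \<beta>")
      case False
      then have "dirichlet_L chi s \<noteq> 0" using uniq[OF s] by blast
      then show ?thesis using mg(4)[of s] s by auto
    qed (use mg(3) in simp)
    have "ln (real D) \<le> exp (real n / 16)"
      using n(1) by (simp add: y_def[symmetric] y)
    then interpret exceptional_zero D chi \<beta> m n g
      using D7 \<beta>34 \<beta>1 mg g0 n by unfold_locales auto
    show ?thesis using L1_compare[OF \<beta>lt] unfolding \<omega>'_def Lb_def d_def \<delta>_def by blast
  qed
  then have low: "lower_const * \<omega>' * Lb \<le> norm (dirichlet_L chi 1)"
    and up: "norm (dirichlet_L chi 1) \<le> upper_const * \<omega>' * Lb" by auto
  have "lower_const * exp (- euler_const) * (\<omega> * T) = lower_const * \<omega> * (exp (- euler_const) * T)" by simp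
  also have "\<dots> \<le> lower_const * \<omega>' * Lb"
    using \<omega>0 \<omega>1 Lb1 T0 lower_const_pos by (intro mult_mono) auto
  finally show "lower_const * exp (- euler_const) * (siegel_omega D \<beta> * T) \<le> norm (dirichlet_L chi 1)"
    using low by (simp add: \<omega>_def)
  have "upper_const * \<omega>' * Lb \<le> upper_const * (17 * \<omega>) * (exp euler_const * T)"
    using \<omega>0 \<omega>1 \<omega>2 Lb2 Lb0 upper_const_pos by (intro mult_mono) auto
  then show "norm (dirichlet_L chi 1) \<le> 17 * upper_const * exp euler_const * (siegel_omega D \<beta> * T)"
    using up by (simp add: \<omega>_def mult_ac)
qed

theorem theorem3:
  "(\<exists>c>0. \<exists>C>0. \<forall>D chi \<beta>. unique_exceptional_zero D chi \<beta> \<longrightarrow>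
      \<bar>siegel_omega D \<beta> * exp (prime_char_sum D chi)\<bar> \<le> c * Re (dirichlet_L chi 1) \<and>
      norm (dirichlet_L chi 1) \<le> C * (siegel_omega D \<beta> * exp (prime_char_sum D chi)))
   \<and>
   (\<exists>c>0. \<exists>C>0. \<forall>D chi \<beta>. unique_exceptional_zero D chi \<beta> \<longrightarrow>
      \<bar>siegel_omega D \<beta> * inverse (ln (ln (real D)))\<bar> \<le> c * Re (dirichlet_L chi 1) \<and>
      norm (dirichlet_L chi 1) \<le> C * (siegel_omega D \<beta> * ln (ln (real D))))
   \<and>
   (\<forall>K>0. \<exists>c>0. \<exists>C>0. \<forall>D chi \<beta>. unique_exceptional_zero D chi \<beta> \<longrightarrow>
      \<bar>1 - \<beta>\<bar> \<le> K * inverse (ln (ln (real D))) \<longrightarrow>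
      \<bar>1 - \<beta>\<bar> \<le> c * Re (dirichlet_L chi 1) \<and>
      norm (dirichlet_L chi 1) \<le> C * ((1 - \<beta>) * (ln (ln (real D)))\<^sup>2))"
proof -
  define c1 where "c1 = inverse (lower_const * exp (- euler_const))"
  define C1 where "C1 = 17 * upper_const * exp euler_const"
  define B where "B = 18 * exp (3 * exp 1 :: real)"
  have pos: "c1 > 0" "C1 > 0" "B > 0"
    using lower_const_pos upper_const_pos by (auto simp: c1_def C1_def B_def)
  have part1: "siegel_omega D \<beta> * exp (prime_char_sum D chi) \<le> c1 * Re (dirichlet_L chi 1)
      \<and> norm (dirichlet_L chi 1) \<le> C1 * (siegel_omega D \<beta> * exp (prime_char_sum D chi))
      \<and> siegel_omega D \<beta> \<ge> 0 \<and> 0 \<le> 1 - \<beta> \<and> ln (ln (real D)) > 1"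
    if "unique_exceptional_zero D chi \<beta>" for D chi \<beta>
  proof -
    note est = exceptional_zero_estimates[OF that]
    have l: "ln (ln (real D)) > 1" using that by (simp add: unique_exceptional_zero_def)
    have "siegel_omega D \<beta> \<ge> 0" using est(4) l by (simp add: siegel_omega_def)
    moreover have "siegel_omega D \<beta> * exp (prime_char_sum D chi) \<le> c1 * Re (dirichlet_L chi 1)"
      unfolding est(3) c1_def using est(1) lower_const_pos
      by (simp add: pos_le_divide_eq mult.commute flip: divide_inverse_commute)
    ultimately show ?thesis using est(2,4) l by (simp add: C1_def)
  qed
  have part2: "siegel_omega D \<beta> * inverse (ln (ln (real D))) \<le> (B * c1) * Re (dirichlet_L chi 1)
      \<and> norm (dirichlet_L chi 1) \<le> (B * C1) * (siegel_omega D \<beta> * ln (ln (real D)))"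
    if ez: "unique_exceptional_zero D chi \<beta>" for D chi \<beta>
  proof -
    define l where "l = ln (ln (real D))"
    define w where "w = siegel_omega D \<beta>"
    define S where "S = prime_char_sum D chi"
    have l: "l > 1" and w: "w \<ge> 0" using part1[OF ez] by (auto simp: l_def w_def)
    \<comment> \<open>Read for S and for -S, this one bound gives both exp S \<le> B l and exp S
      \<ge> 1/(B l).\<close>
    have eB: "exp \<bar>S\<bar> \<le> B * l" using exceptional_zero_estimates(5)[OF ez] by (simp add: B_def S_def l_def)
    have "exp S \<le> exp \<bar>S\<bar>" by simp
    then have up: "exp S \<le> B * l" using eB by linarith
    have "exp (-S) \<le> exp \<bar>S\<bar>" by simp
    then have "exp (-S) \<le> B * l" using eB by linarith
    then have "exp S * exp (-S) \<le> exp S * (B * l)" by (intro mult_left_mono) auto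
    then have "1 \<le> exp S * (B * l)" by (simp flip: exp_add)
    then have low: "inverse l \<le> B * exp S" using l by (simp add: field_simps)
    have "w * inverse l \<le> w * (B * exp S)" using low w by (rule mult_left_mono)
    also have "\<dots> = B * (w * exp S)" by simp
    also have "\<dots> \<le> B * (c1 * Re (dirichlet_L chi 1))"
      using part1[OF ez] pos by (intro mult_left_mono) (auto simp: w_def S_def)
    finally have 1: "w * inverse l \<le> (B * c1) * Re (dirichlet_L chi 1)" by simp
    have "norm (dirichlet_L chi 1) \<le> C1 * (w * exp S)" using part1[OF ez] by (simp add: w_def S_def)
    also have "\<dots> \<le> C1 * (w * (B * l))" using up w pos by (intro mult_left_mono) auto
    finally have "norm (dirichlet_L chi 1) \<le> (B * C1) * (w * l)" by (simp add: mult_ac)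
    with 1 show ?thesis by (simp add: l_def w_def)
  qed
  show ?thesis
  proof (intro conjI allI impI)
    show "\<exists>c>0. \<exists>C>0. \<forall>D chi \<beta>. unique_exceptional_zero D chi \<beta> \<longrightarrow>
      \<bar>siegel_omega D \<beta> * exp (prime_char_sum D chi)\<bar> \<le> c * Re (dirichlet_L chi 1) \<and>
      norm (dirichlet_L chi 1) \<le> C * (siegel_omega D \<beta> * exp (prime_char_sum D chi))"
      using pos part1 by (intro exI[of _ c1] conjI exI[of _ C1]) (auto simp: abs_mult)
    have "\<bar>siegel_omega D \<beta> * inverse (ln (ln (real D)))\<bar> = siegel_omega D \<beta> * inverse (ln (ln (real D)))"
      if "unique_exceptional_zero D chi \<beta>" for D chi \<beta>
      using part1[OF that] by (intro abs_of_nonneg mult_nonneg_nonneg) auto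
    then show "\<exists>c>0. \<exists>C>0. \<forall>D chi \<beta>. unique_exceptional_zero D chi \<beta> \<longrightarrow>
      \<bar>siegel_omega D \<beta> * inverse (ln (ln (real D)))\<bar> \<le> c * Re (dirichlet_L chi 1) \<and>
      norm (dirichlet_L chi 1) \<le> C * (siegel_omega D \<beta> * ln (ln (real D)))"
      using pos part2 by (intro exI[of _ "B * c1"] conjI exI[of _ "B * C1"]) auto
  next
    fix K :: real assume K: "K > 0"
    \<comment> \<open>The maximum serves both branches of w = min 1 ((1 - \<beta>) l): if w = 1,
      then (1 - \<beta>) l \<le> K \<le> M; otherwise (1 - \<beta>) l = w \<le> M w.\<close>
    define M where "M = max 1 K"
    have M: "M \<ge> 1" "M \<ge> K" "M > 0" by (auto simp: M_def)
    have "\<bar>1 - \<beta>\<bar> \<le> (M * (B * c1)) * Re (dirichlet_L chi 1) \<and>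
        norm (dirichlet_L chi 1) \<le> (B * C1) * ((1 - \<beta>) * (ln (ln (real D)))\<^sup>2)"
      if ez: "unique_exceptional_zero D chi \<beta>" and near: "\<bar>1 - \<beta>\<bar> \<le> K * inverse (ln (ln (real D)))"
      for D chi \<beta>
    proof -
      define l where "l = ln (ln (real D))"
      define w where "w = siegel_omega D \<beta>"
      have l: "l > 1" and \<beta>: "0 \<le> 1 - \<beta>" using part1[OF ez] by (auto simp: l_def)
      have w: "w = min 1 ((1 - \<beta>) * l)" by (simp add: w_def siegel_omega_def l_def)
      have p2: "w * inverse l \<le> (B * c1) * Re (dirichlet_L chi 1)"
        "norm (dirichlet_L chi 1) \<le> (B * C1) * (w * l)" using part2[OF ez] by (auto simp: w_def l_def)
      have "(1 - \<beta>) * l \<le> K" using near \<beta> l by (simp add: l_def[symmetric] field_simps)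
      then have "(1 - \<beta>) * l \<le> M * 1" using M by linarith
      moreover have "1 * ((1 - \<beta>) * l) \<le> M * ((1 - \<beta>) * l)" using M \<beta> l by (intro mult_right_mono) auto
      ultimately have "(1 - \<beta>) * l \<le> M * w" by (auto simp: w min_def)
      then have "1 - \<beta> \<le> M * (w * inverse l)" using l by (simp add: field_simps)
      also have "\<dots> \<le> M * ((B * c1) * Re (dirichlet_L chi 1))" using p2(1) M by (intro mult_left_mono) auto
      finally have 1: "\<bar>1 - \<beta>\<bar> \<le> (M * (B * c1)) * Re (dirichlet_L chi 1)" using \<beta> by simp
      have "w * l \<le> (1 - \<beta>) * l * l" using l by (intro mult_right_mono) (auto simp: w)
      then have "(B * C1) * (w * l) \<le> (B * C1) * ((1 - \<beta>) * l * l)" using pos by (intro mult_left_mono) auto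
      then have "norm (dirichlet_L chi 1) \<le> (B * C1) * ((1 - \<beta>) * l\<^sup>2)"
        using p2(2) by (simp add: power2_eq_square mult.assoc)
      with 1 show ?thesis by (simp add: l_def)
    qed
    then show "\<exists>c>0. \<exists>C>0. \<forall>D chi \<beta>. unique_exceptional_zero D chi \<beta> \<longrightarrow>
      \<bar>1 - \<beta>\<bar> \<le> K * inverse (ln (ln (real D))) \<longrightarrow>
      \<bar>1 - \<beta>\<bar> \<le> c * Re (dirichlet_L chi 1) \<and>
      norm (dirichlet_L chi 1) \<le> C * ((1 - \<beta>) * (ln (ln (real D)))\<^sup>2)"
      using pos M by (intro exI[of _ "M * (B * c1)"] conjI exI[of _ "B * C1"]) auto
  qed
qed

end
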